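(* There is an absolute constant $C>0$ such that the following hold for every integer $k\ge 1$. In each item the $k$ parameters of $\mathcal{M}$ are distinct, the $k$ parameters of $\mathcal{M}'$ are distinct, and the two parameter sets are different. 1. (Gaussian) Let $\sigma,\epsilon>0$, $\mathcal{M}=\frac1k\sum_{i=1}^k\mathcal{N}(\mu_i,\sigma^2)$ and $\mathcal{M}'=\frac1k\sum_{i=1}^k\mathcal{N}(\mu_i',\sigma^2)$ with $\mu_i,\mu_i'\in\epsilon\mathbb{Z}$. Then $\|\mathcal{M}'-\mathcal{M}\|_{\mathrm{TV}}\ge C^{-1}k^{-1}\exp\big(-C(\sigma/\epsilon)^{2/3}\big)$. 2. (Poisson) Let $N\ge1$ be an integer, $\mathcal{M}=\frac1k\sum_{i=1}^k\mathrm{Poi}(\lambda_i)$ and $\mathcal{M}'=\frac1k\sum_{i=1}^k\mathrm{Poi}(\lambda_i')$ with $\lambda_i,\lambda_i'\in\{0,1,\dots,N\}$. Then $\|\mathcal{M}'-\mathcal{M}\|_{\mathrm{TV}}\ge C^{-1}k^{-1}\exp(-CN^{1/3})$. 3. (Chi-squared) Let $N\ge1$ be an integer, $\mathcal{M}=\frac1k\sum_{i=1}^k\chi^2(\ell_i)$ and $\mathcal{M}'=\frac1k\sum_{i=1}^k\chi^2(\ell_i')$ with $\ell_i,\ell_i'\in\{1,2,\dots,N\}$. Then $\|\mathcal{M}'-\mathcal{M}\|_{\mathrm{TV}}\ge C^{-1}k^{-1}\exp(-CN^{1/3})$. 4. (Negative binomial) Let $N\ge1$ be an integer, $p\in(0,1)$,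 $\mathcal{M}=\frac1k\sum_{i=1}^k\mathrm{NB}(r_i,p)$ and $\mathcal{M}'=\frac1k\sum_{i=1}^k\mathrm{NB}(r_i',p)$ with $r_i,r_i'\in\{1,2,\dots,N\}$. Then $\|\mathcal{M}'-\mathcal{M}\|_{\mathrm{TV}}\ge C^{-1}k^{-1}\exp\big(-C(N/p)^{1/3}\big)$.
   Context: $\|f-f'\|_{\mathrm{TV}}=\frac12\int|f-f'|$ (with a sum in the discrete case) is the total variation distance. $\mathcal{N}(\mu,\sigma^2)$ is the Gaussian with mean $\mu$ and variance $\sigma^2$; $\mathrm{Poi}(\lambda)$ is the Poisson distribution with mean $\lambda$ ($\mathrm{Poi}(0)$ is the point mass at $0$); $\chi^2(\ell)$ is the chi-squared distribution with $\ell$ degrees of freedom; $\mathrm{NB}(r,p)$ has pmf $\binom{x+r-1}{x}(1-p)^rp^x$ on $x\in\{0,1,2,\dots\}$. Mixtures $\frac1k\sum_if_i$ are averages of densities/pmfs. *)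

theory Defs
  imports "HOL-Probability.Probability"
begin

(* f and g are densities with respect to the base measure B: lborel for the continuous families,
   count_space UNIV for the discrete ones, where the integral is the sum. *)
definition tv_dist :: "'a measure \<Rightarrow> ('a \<Rightarrow> real) \<Rightarrow> ('a \<Rightarrow> real) \<Rightarrow> real" where
  "tv_dist B f g = 1 / 2 * (\<integral>x. \<bar>f x - g x\<bar> \<partial>B)"

definition mixture :: "nat \<Rightarrow> (nat \<Rightarrow> 'a \<Rightarrow> real) \<Rightarrow> 'a \<Rightarrow> real" where
  "mixture k f x = 1 / real k * (\<Sum>i=1..k. f i x)"

(* The library's poisson_pmf is only specified for positive rates; Poi(0) is the point mass at 0. *)
definition Poi :: "real \<Rightarrow> nat pmf" where
  "Poi rate = (if rate = 0 then return_pmf 0 else poisson_pmf rate)"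

lemma pmf_Poi:
  assumes "rate \<ge> 0"
  shows "pmf (Poi rate) x = rate ^ x / fact x * exp (- rate)"
  using assms by (cases x) (auto simp: Poi_def)

definition chi_squared_density :: "nat \<Rightarrow> real \<Rightarrow> real" where
  "chi_squared_density l x =
     (if x > 0
      then x powr (real l / 2 - 1) * exp (- x / 2) / (2 powr (real l / 2) * Gamma (real l / 2))
      else 0)"

(* NB(r,p) puts the power r on 1 - p, whereas neg_binomial_pmf puts it on its probability
   argument; hence the complement. *)
definition NB :: "nat \<Rightarrow> real \<Rightarrow> nat pmf" where
  "NB r p = neg_binomial_pmf r (1 - p)"

lemma pmf_NB:
  assumes "0 < p" "p < 1"
  shows "pmf (NB r p) x = real ((x + r - 1) choose x) * (1 - p) ^ r * p ^ x"
  using assms by (simp add: NB_def pmf_neg_binomial)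

end

theory Submission
  imports Defs "HOL-Complex_Analysis.Complex_Analysis"
begin

text \<open>
  Each of the four families has, for suitable bounded test functions \<open>h\<close>, an identity
  \<open>\<integral> h f\<^sub>j = \<kappa> w\<^sup>j\<close> (Fourier transform, generating function or Laplace transform), so twice the
  total variation distance times \<open>k\<close> dominates \<open>\<bar>\<kappa> D(w)\<bar>\<close>, where \<open>D\<close> is a nonzero polynomial with
  coefficients in \<open>{-1, 0, 1}\<close>. The admissible \<open>w\<close> fill a small arc or chord near \<open>w = 1\<close>.
  Writing \<open>D(w) = w\<^sup>m f(w)\<close> with \<open>\<bar>f(0)\<bar> = 1\<close>, one has \<open>\<bar>f(w)\<bar> \<le> 1 / (1 - \<bar>w\<bar>)\<close> in the unit disc
  and \<open>\<bar>f(1/4)\<bar> \<ge> 1/2\<close>. On a lens whose corners are at distance about \<open>s\<close> from \<open>1\<close>, the maximum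
  principle for \<open>f\<close>, weighted by the quadratic vanishing at the corners (which absorbs
  \<open>1 / (1 - \<bar>w\<bar>)\<close>) and by an exponential of the angle under which the corners are seen, gives
  \<open>max \<bar>f\<bar> \<ge> exp (- 40 / s)\<close> on the outer side, independently of the degree. Optimising \<open>s\<close>
  against the loss from \<open>\<kappa> w\<^sup>m\<close> yields the exponents. For the negative binomial family with
  \<open>N p\<^sup>2 \<le> 1\<close> the optimal \<open>s\<close> exceeds the radius \<open>p / (1 + p)\<close> of the admissible disc; there one takes
  \<open>s\<close> of order \<open>1 / sqrt N\<close> and descends to the admissible disc by a three circles argument.
\<close>

subsection \<open>Lower bounds near the point 1\<close>

text \<open>In a triangle the product of two sides is twice the circumradius times the altitude on
  the third side. Here the vertices are \<open>w\<close>, \<open>a\<close> and \<open>cnj a\<close>,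
  and the third side lies on the vertical line through \<open>a\<close>.\<close>

lemma circle_chord_product:
  fixes c x s :: real and w :: complex
  defines "a \<equiv> Complex x s"
  assumes "cmod (w - of_real c) = cmod (a - of_real c)"
  shows "cmod (w - a) * cmod (w - cnj a) = 2 * cmod (a - of_real c) * \<bar>x - Re w\<bar>"
proof -
  obtain u v where w: "w = Complex u v" by (cases w)
  have r: "(u - c)\<^sup>2 + v\<^sup>2 = (x - c)\<^sup>2 + s\<^sup>2"
    using assms by (simp add: w a_def cmod_def)
  have "(cmod (w - a) * cmod (w - cnj a))\<^sup>2 = ((u - x)\<^sup>2 + (v - s)\<^sup>2) * ((u - x)\<^sup>2 + (v + s)\<^sup>2)"
    by (simp add: w a_def power_mult_distrib cmod_power2)
  also have "\<dots> = 4 * ((x - c)\<^sup>2 + s\<^sup>2) * (x - u)\<^sup>2"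
    using r by algebra
  also have "\<dots> = (2 * cmod (a - of_real c) * \<bar>x - Re w\<bar>)\<^sup>2"
    by (simp add: w a_def power_mult_distrib cmod_power2)
  finally show ?thesis
    by (rule power2_eq_imp_eq) auto
qed

text \<open>The normalising factor makes the disc \<open>\<bar>w\<bar> < \<bar>A\<bar>\<close> correspond to the upper half plane, with its
  boundary arc to the left of the chord from \<open>A\<close> to \<open>cnj A\<close> going to the positive reals. Hence
  \<open>Im (Ln (lens_map A w))\<close> is a multiple of the harmonic measure of the right-hand arc.\<close>

definition lens_map :: "complex \<Rightarrow> complex \<Rightarrow> complex" where
  "lens_map A w = cnj A / of_real (cmod A) * ((w - A) / (w - cnj A))"

text \<open>Clearing the denominator leaves \<open>cnj A * (w - A) * (cnj w - A)\<close>, from which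
  the signs of both parts can be read off.\<close>

lemma lens_map_scaled:
  assumes "w \<noteq> cnj A" "A \<noteq> 0"
  shows "Re (lens_map A w) * ((cmod (w - cnj A))\<^sup>2 * cmod A) = 
           Re A * ((cmod w)\<^sup>2 + (cmod A)\<^sup>2) - 2 * (cmod A)\<^sup>2 * Re w"
    and "Im (lens_map A w) * ((cmod (w - cnj A))\<^sup>2 * cmod A) = Im A * ((cmod A)\<^sup>2 - (cmod w)\<^sup>2)"
proof -
  have "lens_map A w * of_real ((cmod (w - cnj A))\<^sup>2 * cmod A) =
          cnj A * ((w - A) / (w - cnj A)) * of_real ((cmod (w - cnj A))\<^sup>2)"
    using assms by (simp add: lens_map_def)
  also have "\<dots> = cnj A * (w - A) * (cnj w - A)"
    using assms by (simp add: complex_norm_square field_simps del: of_real_power)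
  finally have eq: "lens_map A w * of_real ((cmod (w - cnj A))\<^sup>2 * cmod A) = cnj A * (w - A) * (cnj w - A)" .
  have sc: "Re (z * of_real t) = Re z * t" "Im (z * of_real t) = Im z * t" for z t
    by simp_all
  show "Re (lens_map A w) * ((cmod (w - cnj A))\<^sup>2 * cmod A) = 
           Re A * ((cmod w)\<^sup>2 + (cmod A)\<^sup>2) - 2 * (cmod A)\<^sup>2 * Re w"
    unfolding sc[symmetric] eq unfolding cmod_power2 by (simp add: algebra_simps power2_eq_square)
  show "Im (lens_map A w) * ((cmod (w - cnj A))\<^sup>2 * cmod A) = Im A * ((cmod A)\<^sup>2 - (cmod w)\<^sup>2)"
    unfolding sc[symmetric] eq unfolding cmod_power2 by (simp add: algebra_simps power2_eq_square)
qed

lemma Im_lens_map_pos: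
  assumes "Im A > 0" "cmod w < cmod A"
  shows "Im (lens_map A w) > 0"
proof -
  have ne: "w \<noteq> cnj A" "A \<noteq> 0" using assms by auto
  have pos: "(cmod (w - cnj A))\<^sup>2 * cmod A > 0" using ne by simp
  have "(cmod w)\<^sup>2 < (cmod A)\<^sup>2" using assms by (simp add: power_strict_mono)
  then have "Im (lens_map A w) * ((cmod (w - cnj A))\<^sup>2 * cmod A) > 0"
    using assms by (simp add: lens_map_scaled(2)[OF ne])
  then show ?thesis using pos by (simp add: zero_less_mult_iff)
qed

lemma lens_map_arc:
  assumes "Im A > 0" "cmod w = cmod A" "Re w < Re A"
  shows "Im (lens_map A w) = 0" "Re (lens_map A w) > 0"
proof -
  have ne: "w \<noteq> cnj A" "A \<noteq> 0" using assms by auto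
  have pos: "(cmod (w - cnj A))\<^sup>2 * cmod A > 0" using ne by simp
  show "Im (lens_map A w) = 0"
    using lens_map_scaled(2)[OF ne] assms ne by auto
  have "Re (lens_map A w) * ((cmod (w - cnj A))\<^sup>2 * cmod A) = 2 * (cmod A)\<^sup>2 * (Re A - Re w)"
    using lens_map_scaled(1)[OF ne] assms by (simp add: algebra_simps)
  also have "\<dots> > 0" using assms ne by simp
  finally show "Re (lens_map A w) > 0" using pos by (simp add: zero_less_mult_iff)
qed

lemma lens_map_0:
  assumes "A \<noteq> 0" 
  shows "lens_map A 0 = A / of_real (cmod A)"
  using assms by (simp add: lens_map_def)

text \<open>The sine of the angle \<open>Im (Ln z)\<close> is \<open>Im z / cmod z\<close>, and
  \<open>sin x \<le> x\<close> for nonnegative \<open>x\<close>.\<close>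

lemma Im_Ln_ge:
  assumes "z \<noteq> 0" "Im z \<ge> 0"
  shows "Im (Ln z) \<ge> Im z / cmod z"
proof -
  have "exp (Ln z) = z" using assms by simp
  then have "Im z = exp (Re (Ln z)) * sin (Im (Ln z))" by (metis Im_exp)
  then have "Im z / cmod z = sin (Im (Ln z))" using assms by simp
  moreover have "Im (Ln z) \<ge> 0" using Im_Ln_pos_le[OF assms(1)] assms(2) by simp
  ultimately show ?thesis by (simp add: sin_x_le_x)
qed

section \<open>The maximum principle on a lens\<close>

text \<open>Meant for the corners of the lens, where the quadratic factor vanishes and the
  exponential weight is bounded but has no limit. The bound is asked only where \<open>f\<close> is
  nonzero, because at the corners themselves the weight has merely a default value.\<close>

lemma isCont_mult_bounded:
  fixes f g :: "complex \<Rightarrow> complex"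
  assumes "isCont f a" "f a = 0" "\<And>w. f w \<noteq> 0 \<Longrightarrow> cmod (g w) \<le> K"
  shows "isCont (\<lambda>w. f w * g w) a"
proof -
  have "((\<lambda>w. cmod (f w) * K) \<longlongrightarrow> cmod (f a) * K) (at a)"
    using assms(1) unfolding isCont_def by (intro tendsto_intros)
  then have "((\<lambda>w. cmod (f w) * K) \<longlongrightarrow> 0) (at a)" using assms(2) by simp
  moreover have "cmod (f w * g w) \<le> cmod (f w) * K" for w
    using assms(3)[of w] by (cases "f w = 0") (auto simp: norm_mult intro!: mult_left_mono)
  ultimately have "((\<lambda>w. f w * g w) \<longlongrightarrow> 0) (at a)"
    using Lim_null_comparison[of "\<lambda>w. f w * g w" "\<lambda>w. cmod (f w) * K" "at a"]
    by (simp add: always_eventually)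
  then show ?thesis unfolding isCont_def using assms(2) by simp
qed

text \<open>On the left arc of the circle only the growth bound \<open>f_le\<close> is available; on
  the rest of the frontier \<open>f\<close> is at most \<open>M\<close>. If \<open>M\<close> were
  too small, the weighted function \<open>F\<close> would be larger at 1/4 than its frontier values
  allow.\<close>

lemma lens_lower_bound:
  fixes f :: "complex \<Rightarrow> complex" and \<Omega> :: "complex set" and x s M :: real
  defines "a \<equiv> Complex x s"
  defines "r \<equiv> cmod (a - 1/4)"
  assumes holf: "f holomorphic_on UNIV"
    and f_le: "\<And>w. cmod w < 1 \<Longrightarrow> cmod (f w) * (1 - cmod w) \<le> 1"
    and f_ge: "cmod (f (1/4)) \<ge> 1/2"
    and x: "x \<ge> 1/2" and s: "s > 0" and a: "cmod a \<le> 1"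
    and \<Omega>: "open \<Omega>" "\<Omega> \<subseteq> ball (1/4) r" "1/4 \<in> \<Omega>"
    and front: "\<And>w. w \<in> frontier \<Omega> \<Longrightarrow>
          w \<in> ball (1/4) r \<and> cmod (f w) \<le> M \<or> w \<in> sphere (1/4) r \<and> Re w \<le> x"
  shows "M \<ge> exp (- 40 / s)"
proof (rule ccontr)
  assume M: "\<not> M \<ge> exp (- 40 / s)"
  define A where "A = a - 1/4"
  have A: "Re A = x - 1/4" "Im A = s" "cmod A = r" "A \<noteq> 0" "cnj A = cnj a - 1/4"
    using s by (auto simp: A_def a_def r_def complex_eq_iff)
  have s1: "s \<le> 1" using a abs_Im_le_cmod[of a] s by (simp add: a_def)
  have r_ge: "r \<ge> 1/4" using abs_Re_le_cmod[of A] A x by simp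
  have r_le: "r \<le> 5/4" using norm_triangle_ineq4[of a "1/4"] a by (simp add: r_def)
  \<comment> \<open>This weight gains a factor of at least \<open>exp (10 / r) \<ge> exp 8\<close>
    at the point 1/4. It costs at most \<open>exp (10 * pi / s)\<close> on the frontier inside the
    disc, less than the \<open>exp (40 / s)\<close> at disposal.\<close>
  define B where "B = 10 / s"
  have B: "B \<ge> 0" using s by (simp add: B_def)
  define Z where "Z = (\<lambda>w. lens_map A (w - 1/4))"
  define G where "G = (\<lambda>w. exp (- \<i> * of_real B * Ln (Z w)))"
  define Q where "Q = (\<lambda>w. (w - a) * (w - cnj a))"
  define F where "F = (\<lambda>w. f w * Q w * G w)"
  have norm_G: "cmod (G w) = exp (B * Im (Ln (Z w)))" for w
    by (simp add: G_def)
  have G_le: "cmod (G w) \<le> exp (B * pi)" if "Z w \<noteq> 0" for w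
    unfolding norm_G using B that by (simp add: Im_Ln_le_pi mult_left_mono)
  have ball: "cmod (w - 1/4) < r" if "w \<in> ball (1/4) r" for w
    using that by (simp add: dist_norm norm_minus_commute)
  have sphere: "cmod (w - 1/4) = r" if "w \<in> sphere (1/4) r" for w
    using that by (simp add: dist_norm norm_minus_commute)
  have Z_ball: "Im (Z w) > 0" if "w \<in> ball (1/4) r" for w
    unfolding Z_def using ball[OF that] A s by (intro Im_lens_map_pos) auto
  have Z_arc: "Im (Z w) = 0 \<and> Re (Z w) > 0" if "w \<in> sphere (1/4) r" "Re w < x" for w
    unfolding Z_def using sphere[OF that(1)] A s that(2) lens_map_arc[of A "w - 1/4"] by simp
  have corner: "w = a \<or> w = cnj a" if "w \<in> sphere (1/4) r" "Re w = x" for w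
  proof -
    have "(Re w - 1/4)\<^sup>2 + (Im w)\<^sup>2 = (x - 1/4)\<^sup>2 + s\<^sup>2"
      using arg_cong[OF sphere[OF that(1)], of "\<lambda>u. u\<^sup>2"] by (simp add: r_def a_def cmod_power2)
    then have "(Im w)\<^sup>2 = s\<^sup>2" using that by simp
    then show ?thesis using that(2) by (auto simp: a_def complex_eq_iff power2_eq_iff)
  qed
  have Q_corner: "Q a = 0" "Q (cnj a) = 0" by (simp_all add: Q_def)
  have Z_nz: "Z w \<noteq> 0" if "f w * Q w \<noteq> 0" for w
  proof -
    have "w - 1/4 - A \<noteq> 0" "w - 1/4 - cnj A \<noteq> 0"
      using that unfolding A(5) by (auto simp: Q_def A_def)
    then show ?thesis using A(4) by (simp add: Z_def lens_map_def)
  qed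
  have contf: "isCont f w" for w
    using holf holomorphic_on_imp_continuous_on continuous_on_eq_continuous_at by blast
  have contQ: "isCont Q w" for w unfolding Q_def by (intro continuous_intros)
  have holZ: "Z holomorphic_on ball (1/4) r"
  proof -
    have "w - 1/4 - cnj A \<noteq> 0" if "w \<in> ball (1/4) r" for w
    proof
      assume "w - 1/4 - cnj A = 0"
      then have "cmod (w - 1/4) = cmod (cnj A)" by simp
      then show False using ball[OF that] A(3) by simp
    qed
    then show ?thesis unfolding Z_def lens_map_def using A
      by (intro holomorphic_intros) auto
  qed
  have nonpos: "z \<notin> \<real>\<^sub>\<le>\<^sub>0" if "Im z > 0 \<or> Im z = 0 \<and> Re z > 0" for z
    using that by (auto simp: complex_nonpos_Reals_iff)
  have holF: "F holomorphic_on ball (1/4) r"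
  proof -
    have "Z w \<notin> \<real>\<^sub>\<le>\<^sub>0" if "w \<in> ball (1/4) r" for w
      using nonpos Z_ball that by blast
    then show ?thesis unfolding F_def Q_def G_def
      using holf holZ by (intro holomorphic_intros) (auto intro: holomorphic_on_subset)
  qed
  have contF: "isCont F w" if "w \<in> closure \<Omega>" for w
  proof -
    have "w \<in> ball (1/4) r \<or> w \<in> sphere (1/4) r \<and> Re w < x \<or> w = a \<or> w = cnj a"
      using that front[of w] corner[of w] \<Omega>(2) closure_Un_frontier[of \<Omega>] by force
    then consider "w \<in> ball (1/4) r" | "w \<in> sphere (1/4) r" "Re w < x" | "w = a \<or> w = cnj a"
      by blast
    then show ?thesis
    proof cases
      case 1
      then show ?thesis using holF
        by (meson continuous_on_eq_continuous_at holomorphic_on_imp_continuous_on open_ball)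
    next
      case 2
      then have "w \<noteq> cnj a" by (auto simp: a_def)
      then have "isCont Z w" unfolding Z_def lens_map_def using A
        by (intro continuous_intros) auto
      then have "isCont G w" unfolding G_def using nonpos[of "Z w"] Z_arc[OF 2]
        by (intro continuous_intros) auto
      then show ?thesis unfolding F_def using contf contQ by (intro continuous_intros)
    next
      case 3
      then show ?thesis unfolding F_def
        using contf contQ Q_corner
        by (intro isCont_mult_bounded[OF _ _ G_le]) (auto intro!: continuous_intros simp: Z_nz)
    qed
  qed
  define L where "L = cmod (F (1/4))"
  have L: "L \<ge> r\<^sup>2 / 2 * exp (B * s / r)"
  proof -
    have "Z (1/4) = A / of_real r" using lens_map_0[OF A(4)] A by (simp add: Z_def)
    moreover have "A / of_real r \<noteq> 0" "Im (A / of_real r) = s / r" "cmod (A / of_real r) = 1" 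
      using A r_ge by (auto simp: norm_divide Im_divide_of_real)
    ultimately have "Im (Ln (Z (1/4))) \<ge> s / r"
      using Im_Ln_ge[of "A / of_real r"] s r_ge by (simp add: Im_divide_of_real)
    then have "B * (s / r) \<le> B * Im (Ln (Z (1/4)))"
      using B by (rule mult_left_mono)
    then have "cmod (G (1/4)) \<ge> exp (B * s / r)"
      unfolding norm_G by simp
    moreover have "cmod (Q (1/4)) = r\<^sup>2"
    proof -
      have "cmod (1/4 - a) = r" by (simp add: r_def norm_minus_commute)
      moreover have "cmod (1/4 - cnj a) = cmod (cnj (1/4 - a))" by simp
      ultimately show ?thesis by (simp add: Q_def norm_mult power2_eq_square del: complex_cnj_diff)
    qed
    ultimately have "1/2 * r\<^sup>2 * exp (B * s / r) \<le> cmod (f (1/4)) * cmod (Q (1/4)) * cmod (G (1/4))"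
      using f_ge by (intro mult_mono) auto
    then show ?thesis by (simp add: L_def F_def norm_mult)
  qed
  \<comment> \<open>The frontier inside the disc contributes at most \<open>L / 2\<close>, which
    cannot bound the positive number \<open>L\<close>. So the bound \<open>8 * r\<close> from the
    arc, where \<open>G\<close> has modulus 1, must hold.\<close>
  have "L \<le> max (8 * r) (L / 2)"
    unfolding L_def
  proof (rule maximum_modulus_frontier[where S = \<Omega> and f = F and \<xi> = "1/4"])
    show "F holomorphic_on interior \<Omega>"
      using holF \<Omega> by (metis holomorphic_on_subset interior_open)
    show "continuous_on (closure \<Omega>) F"
      using contF by (intro continuous_at_imp_continuous_on) blast
    show "bounded \<Omega>" using \<Omega> bounded_ball bounded_subset by blast
    show "1/4 \<in> \<Omega>" by fact
    fix w assume w: "w \<in> frontier \<Omega>"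
    consider "w \<in> ball (1/4) r" "cmod (f w) \<le> M" | "w \<in> sphere (1/4) r" "Re w < x" | "w = a \<or> w = cnj a"
      using front[OF w] corner[of w] by force
    then show "cmod (F w) \<le> max (8 * r) (cmod (F (1/4)) / 2)"
    proof cases
      case 1
      have "cmod (w - a) \<le> 2 * r" "cmod (w - cnj a) \<le> 2 * r"
        using norm_triangle_ineq4[of "w - 1/4" A] norm_triangle_ineq4[of "w - 1/4" "cnj A"] ball[OF 1(1)]
          A(3) complex_mod_cnj[of A]
        unfolding A(5) by (auto simp: A_def)
      then have "cmod (Q w) \<le> 2 * r * (2 * r)"
        unfolding Q_def norm_mult using r_ge by (intro mult_mono) auto
      moreover have "cmod (G w) \<le> exp (B * pi)" using Z_ball[OF 1(1)] by (intro G_le) auto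
      moreover have "0 \<le> M" using 1(2) norm_ge_zero[of "f w"] by linarith
      ultimately have "cmod (F w) \<le> M * (2 * r * (2 * r)) * exp (B * pi)"
        unfolding F_def norm_mult using 1 r_ge by (intro mult_mono) auto
      also have "\<dots> \<le> exp (-40 / s) * (2 * r * (2 * r)) * exp (B * pi)"
        using M by (intro mult_right_mono) auto
      also have "\<dots> = 4 * r\<^sup>2 * exp (10 * pi / s - 40 / s)"
        by (simp add: B_def exp_diff exp_minus power2_eq_square field_simps)
      finally have F_le: "cmod (F w) \<le> 4 * r\<^sup>2 * exp (10 * pi / s - 40 / s)" .
      have "10 * pi / s - 40 / s \<le> - 4"
      proof -
        have "pi < 3.6" using pi_approx by simp
        then have "4 * s \<le> 40 - 10 * pi" using s1 by linarith
        then show ?thesis using s by (simp add: field_simps)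
      qed
      then have "exp (10 * pi / s - 40 / s) \<le> exp (- 4)" by simp
      also have "exp (- 4 :: real) \<le> 1/16"
      proof -
        have "(16::real) \<le> exp 4" 
          using power_mono[of 2 "exp 1 :: real" 4] exp_ge_add_one_self[of 1] by (simp add: exp_of_nat_mult[symmetric])
        then show ?thesis by (simp add: exp_minus field_simps)
      qed
      finally have "4 * r\<^sup>2 * exp (10 * pi / s - 40 / s) \<le> 4 * r\<^sup>2 * (1/16)"
        by (intro mult_left_mono) auto
      then have "cmod (F w) \<le> r\<^sup>2 / 4" using F_le by simp
      also have "\<dots> \<le> r\<^sup>2 / 4 * exp (B * s / r)"
        using B s r_ge by (simp add: mult_le_cancel_left1)
      also have "\<dots> \<le> L / 2" using L by simp
      finally show ?thesis by (simp add: L_def)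
    next
      case 2
      have Qw: "cmod (Q w) = 2 * r * (x - Re w)"
        using circle_chord_product[of w "1/4" x s] sphere[OF 2(1)] 2(2)
        by (simp add: Q_def norm_mult a_def r_def)
      have "(Re w - 1/4)\<^sup>2 + (Im w)\<^sup>2 = (x - 1/4)\<^sup>2 + s\<^sup>2"
        using arg_cong[OF sphere[OF 2(1)], of "\<lambda>u. u\<^sup>2"] by (simp add: r_def a_def cmod_power2)
      moreover have "x\<^sup>2 + s\<^sup>2 \<le> 1"
        using a by (simp add: a_def cmod_def)
      \<comment> \<open>On a circle about 1/4 the quantity
        \<open>(cmod w)\<^sup>2 - Re w / 2\<close> is constant. The shifted centre thus makes the
        distance to the unit circle at least proportional to the distance from the chord, and
        \<open>Q\<close> absorbs the growth of \<open>f\<close>.\<close>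
      ultimately have w2: "1 - (cmod w)\<^sup>2 \<ge> (x - Re w) / 2"
        unfolding cmod_power2 by (simp add: power2_eq_square algebra_simps diff_divide_distrib)
      then have "(cmod w)\<^sup>2 < 1\<^sup>2" using 2(2) by simp
      then have w1: "cmod w < 1" by (rule power2_less_imp_less) simp
      have "1 - (cmod w)\<^sup>2 \<le> 2 * (1 - cmod w)"
        using zero_le_power2[of "1 - cmod w"] unfolding power2_diff by simp
      from order_trans[OF w2 this] have w3: "x - Re w \<le> 4 * (1 - cmod w)" by (simp add: field_simps)
      have "Im (Ln (Z w)) = 0"
        using Z_arc[OF 2] Im_Ln_eq_0[of "Z w"] by force
      then have "cmod (F w) = cmod (f w) * (2 * r * (x - Re w))"
        by (simp add: F_def norm_mult norm_G Qw)
      also have "\<dots> \<le> cmod (f w) * (2 * r * (4 * (1 - cmod w)))"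
        using w3 r_ge by (intro mult_left_mono) auto
      also have "\<dots> = 8 * r * (cmod (f w) * (1 - cmod w))" by simp
      also have "\<dots> \<le> 8 * r * 1" using f_le[OF w1] r_ge by (intro mult_left_mono) auto
      finally show ?thesis by simp
    next
      case 3
      then have "F w = 0" using Q_corner by (auto simp: F_def)
      then show ?thesis using r_ge by simp
    qed
  qed
  moreover have "L > 0" 
    using less_le_trans[OF _ L, of 0] r_ge by simp
  ultimately have "L \<le> 8 * r" by auto
  \<comment> \<open>The gain \<open>exp 8 \<ge> 256\<close> wins, since \<open>r \<ge> 1/4\<close>
    gives \<open>r \<le> 4 * r\<^sup>2\<close>.\<close>
  moreover have "8 * r < L"
  proof -
    have "10 / r \<ge> 8" using r_le r_ge by (simp add: field_simps)
    then have "exp (8::real) \<le> exp (B * s / r)" using s by (simp add: B_def)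
    moreover have "(256::real) \<le> exp 8" 
      using power_mono[of 2 "exp 1 :: real" 8] exp_ge_add_one_self[of 1] by (simp add: exp_of_nat_mult[symmetric])
    ultimately have e: "256 \<le> exp (B * s / r)" by linarith
    have "r \<le> 4 * r\<^sup>2" using r_ge by (simp add: power2_eq_square)
    then have "8 * r \<le> r\<^sup>2 / 2 * 64" by simp
    also have "\<dots> < r\<^sup>2 / 2 * exp (B * s / r)"
      using e r_ge by (intro mult_strict_left_mono) auto
    finally show ?thesis using L by linarith
  qed
  ultimately show False by simp
qed

section \<open>Polynomials whose nonzero coefficients have modulus 1\<close>

locale unit_coeffs =
  fixes e :: "nat \<Rightarrow> complex" and N :: nat
  assumes norm_coeff: "e j \<noteq> 0 \<Longrightarrow> cmod (e j) = 1"
    and nonzero: "\<exists>j\<le>N. e j \<noteq> 0"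
begin

lemma norm_coeff_le: "cmod (e j) \<le> 1"
  using norm_coeff[of j] by (cases "e j = 0") auto

text \<open>The lowest nonvanishing power \<open>m\<close> is taken out. A geometric series bounds
  \<open>f\<close> in the unit disc; at 1/4 the terms after the constant one sum to at most 1/3, so
  the constant term of modulus 1 dominates.\<close>

lemma factor:
  obtains m f where "m \<le> N" "f holomorphic_on UNIV"
    "\<And>w. (\<Sum>j\<le>N. e j * w ^ j) = w ^ m * f w"
    "\<And>w. cmod w < 1 \<Longrightarrow> cmod (f w) * (1 - cmod w) \<le> 1"
    "cmod (f (1/4)) \<ge> 1/2"
proof -
  define m where "m = (LEAST j. e j \<noteq> 0)"
  obtain j0 where j0: "j0 \<le> N" "e j0 \<noteq> 0" using nonzero by blast
  have em: "e m \<noteq> 0" unfolding m_def using j0 by (rule_tac LeastI)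
  have mN: "m \<le> N" unfolding m_def using j0 Least_le[of "\<lambda>j. e j \<noteq> 0" j0] by simp
  have below: "e j = 0" if "j < m" for j using that not_less_Least unfolding m_def by blast
  define f where "f = (\<lambda>w. \<Sum>j\<le>N - m. e (j + m) * w ^ j)"
  have geo: "(\<Sum>j\<le>n. t ^ j) * (1 - t) \<le> 1" if "0 \<le> t" for t :: real and n
    using that sum_gp_basic[of t n] by (simp add: mult.commute)
  have norm_term: "cmod (e j * w ^ i) \<le> cmod w ^ i" for i j w
    using norm_coeff_le[of j] by (simp add: norm_mult norm_power mult_left_le_one_le)
  show ?thesis
  proof
    show "m \<le> N" by fact
    show "f holomorphic_on UNIV" unfolding f_def by (intro holomorphic_intros)
    fix w :: complex
    have "(\<Sum>j\<le>N. e j * w ^ j) = (\<Sum>j\<in>{0 + m..N - m + m}. e j * w ^ j)"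
      using below mN by (intro sum.mono_neutral_right) (auto simp: not_le)
    also have "\<dots> = (\<Sum>j\<le>N - m. e (j + m) * w ^ (j + m))"
      unfolding sum.shift_bounds_cl_nat_ivl by (simp add: atLeast0AtMost)
    also have "\<dots> = w ^ m * f w"
      by (simp add: f_def sum_distrib_left power_add mult_ac)
    finally show "(\<Sum>j\<le>N. e j * w ^ j) = w ^ m * f w" .
    show "cmod (f w) * (1 - cmod w) \<le> 1" if "cmod w < 1"
    proof -
      have "cmod (f w) \<le> (\<Sum>j\<le>N - m. cmod w ^ j)"
        unfolding f_def by (intro sum_norm_le norm_term)
      then have "cmod (f w) * (1 - cmod w) \<le> (\<Sum>j\<le>N - m. cmod w ^ j) * (1 - cmod w)"
        using that by (intro mult_right_mono) auto
      also have "\<dots> \<le> 1" by (rule geo) simp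
      finally show ?thesis .
    qed
  next
    have split: "(\<Sum>j\<le>n. g j) = g 0 + (\<Sum>j\<in>{..n} - {0}. g j)" for n :: nat and g :: "nat \<Rightarrow> 'b::comm_monoid_add"
      by (intro sum.remove) auto
    have "f (1/4) = e m + (\<Sum>j\<in>{..N - m} - {0}. e (j + m) * (1/4) ^ j)"
      unfolding f_def by (subst split) simp
    moreover have "cmod (\<Sum>j\<in>{..N - m} - {0}. e (j + m) * (1/4) ^ j) \<le> 1/2"
    proof -
      have "cmod (\<Sum>j\<in>{..N - m} - {0}. e (j + m) * (1/4) ^ j) \<le> (\<Sum>j\<in>{..N - m} - {0}. (1/4) ^ j)"
        using norm_term[of _ "1/4"] by (intro sum_norm_le) simp
      also have "\<dots> = (\<Sum>j\<le>N - m. (1/4) ^ j) - 1"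
        by (subst split) simp
      also have "\<dots> \<le> 1/2" using geo[of "1/4" "N - m"] by simp
      finally show ?thesis .
    qed
    moreover have "cmod (e m) - cmod (- (\<Sum>j\<in>{..N - m} - {0}. e (j + m) * (1/4) ^ j)) \<le>
        cmod (e m - - (\<Sum>j\<in>{..N - m} - {0}. e (j + m) * (1/4) ^ j))"
      by (rule norm_triangle_ineq2)
    ultimately show "cmod (f (1/4)) \<ge> 1/2" using norm_coeff[OF em] by simp
  qed
qed

text \<open>The lens is the disc about 1/4 cut off by the vertical chord; \<open>K \<ge> 1\<close>
  keeps its corners in the closed unit disc. Dividing by \<open>w ^ m\<close> costs at most the
  factor \<open>x ^ N\<close>, hence the second term of the exponent.\<close>

lemma chord_lower_bound:
  fixes s K \<epsilon> :: real
  assumes s: "s > 0" and K: "K \<ge> 1" "K * s\<^sup>2 \<le> 1/2"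
    and le: "\<And>w. Re w = 1 - K * s\<^sup>2 \<Longrightarrow> \<bar>Im w\<bar> \<le> s \<Longrightarrow> cmod (\<Sum>j\<le>N. e j * w ^ j) \<le> \<epsilon>"
  shows "\<epsilon> \<ge> exp (- 40 / s - 2 * K * real N * s\<^sup>2)"
proof -
  obtain m f where f: "m \<le> N" "f holomorphic_on UNIV"
    "\<And>w. (\<Sum>j\<le>N. e j * w ^ j) = w ^ m * f w"
    "\<And>w. cmod w < 1 \<Longrightarrow> cmod (f w) * (1 - cmod w) \<le> 1"
    "cmod (f (1/4)) \<ge> 1/2"
    using factor by blast
  define x where "x = 1 - K * s\<^sup>2"
  have x: "x \<ge> 1/2" "x \<le> 1" using K by (auto simp: x_def)
  define r where "r = cmod (Complex x s - 1/4)"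
  have r2: "r\<^sup>2 = (x - 1/4)\<^sup>2 + s\<^sup>2" by (simp add: r_def cmod_power2)
  have r: "r > 0" using s by (auto simp: r_def complex_eq_iff)
  define \<Omega> where "\<Omega> = ball (1/4 :: complex) r \<inter> {w. Re w < x}"
  have op: "open \<Omega>" unfolding \<Omega>_def by (intro open_Int open_ball open_halfspace_Re_lt)
  have "\<epsilon> / x ^ N \<ge> exp (- 40 / s)"
  proof (rule lens_lower_bound[OF f(2,4,5) x(1) s, folded r_def])
    show "cmod (Complex x s) \<le> 1"
    proof -
      have "s\<^sup>2 \<le> K * s\<^sup>2" using K by (simp add: mult_le_cancel_right1)
      moreover have "(K * s\<^sup>2)\<^sup>2 \<le> K * s\<^sup>2 * 1"
        unfolding power2_eq_square[of "K * s\<^sup>2"] using K by (intro mult_left_mono) auto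
      ultimately have "(cmod (Complex x s))\<^sup>2 \<le> 1\<^sup>2"
        by (simp add: cmod_power2 x_def power2_diff)
      then show ?thesis by (rule power2_le_imp_le) simp
    qed
    show "open \<Omega>" by fact
    show "\<Omega> \<subseteq> ball (1/4) r" by (simp add: \<Omega>_def)
    show "1/4 \<in> \<Omega>" using r x by (simp add: \<Omega>_def)
    fix w assume w: "w \<in> frontier \<Omega>"
    have "closure \<Omega> \<subseteq> cball (1/4) r \<inter> {w. Re w \<le> x}"
      by (intro closure_minimal closed_Int closed_cball closed_halfspace_Re_le) (auto simp: \<Omega>_def)
    then have wr: "w \<in> cball (1/4) r" "Re w \<le> x" "w \<notin> \<Omega>"
      using w op by (auto simp: frontier_def interior_open)
    show "w \<in> ball (1/4) r \<and> cmod (f w) \<le> \<epsilon> / x ^ N \<or> w \<in> sphere (1/4) r \<and> Re w \<le> x"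
    proof (cases "w \<in> ball (1/4) r")
      case True
      then have wx: "Re w = x" using wr by (auto simp: \<Omega>_def)
      have "(cmod (w - 1/4))\<^sup>2 < r\<^sup>2"
        using True by (intro power_strict_mono) (auto simp: dist_norm norm_minus_commute)
      then have "(Im w)\<^sup>2 < s\<^sup>2" by (simp add: cmod_power2 r2 wx)
      then have "\<bar>Im w\<bar> \<le> s" using s abs_le_square_iff[of "Im w" s] by simp
      then have "cmod (w ^ m * f w) \<le> \<epsilon>" using le[of w] wx f(3)[of w] by (simp add: x_def)
      then have 1: "cmod w ^ m * cmod (f w) \<le> \<epsilon>" by (simp add: norm_mult norm_power)
      have "x ^ N \<le> x ^ m" using x f(1) by (intro power_decreasing) auto
      also have "\<dots> \<le> cmod w ^ m" 
        using x wx abs_Re_le_cmod[of w] by (intro power_mono) auto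
      finally have "x ^ N * cmod (f w) \<le> cmod w ^ m * cmod (f w)"
        by (rule mult_right_mono) simp
      then have "x ^ N * cmod (f w) \<le> \<epsilon>" using 1 by linarith
      then have "cmod (f w) \<le> \<epsilon> / x ^ N" using x by (simp add: field_simps)
      then show ?thesis using True by simp
    next
      case False
      then show ?thesis using wr by auto
    qed
  qed
  then have "exp (- 40 / s) * x ^ N \<le> \<epsilon>" using x by (simp add: field_simps)
  moreover have "x ^ N \<ge> exp (- 2 * K * real N * s\<^sup>2)"
  proof -
    have "- (K * s\<^sup>2) - 2 * (K * s\<^sup>2)\<^sup>2 \<le> ln x"
      unfolding x_def using K by (intro ln_one_minus_pos_lower_bound) auto
    moreover have "2 * (K * s\<^sup>2)\<^sup>2 \<le> K * s\<^sup>2 * 1"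
      unfolding power2_eq_square[of "K * s\<^sup>2"] using K 
        mult_left_mono[of "2 * (K * s\<^sup>2)" 1 "K * s\<^sup>2"] by simp
    ultimately have "- 2 * K * s\<^sup>2 \<le> ln x" by simp
    then have "exp (- 2 * K * s\<^sup>2) \<le> x" using x by (simp add: ln_ge_iff)
    then have "exp (- 2 * K * s\<^sup>2) ^ N \<le> x ^ N" by (intro power_mono) auto
    then show ?thesis by (simp add: exp_of_nat_mult[symmetric] mult_ac)
  qed
  then have "exp (- 40 / s) * exp (- 2 * K * real N * s\<^sup>2) \<le> exp (- 40 / s) * x ^ N"
    by (intro mult_left_mono) auto
  ultimately show ?thesis by (simp add: exp_add[symmetric])
qed

text \<open>The lens is now cut off by the unit circle itself, on which \<open>w ^ m\<close> has
  modulus 1, so no loss depending on \<open>N\<close> arises.\<close>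

lemma arc_lower_bound:
  fixes \<delta> \<epsilon> :: real
  assumes \<delta>: "0 < \<delta>" "\<delta> \<le> 1"
    and le: "\<And>\<theta>. \<bar>\<theta>\<bar> \<le> \<delta> \<Longrightarrow> cmod (\<Sum>j\<le>N. e j * cis \<theta> ^ j) \<le> \<epsilon>"
  shows "\<epsilon> \<ge> exp (- 40 / sin \<delta>)"
proof -
  obtain m f where f: "m \<le> N" "f holomorphic_on UNIV"
    "\<And>w. (\<Sum>j\<le>N. e j * w ^ j) = w ^ m * f w"
    "\<And>w. cmod w < 1 \<Longrightarrow> cmod (f w) * (1 - cmod w) \<le> 1"
    "cmod (f (1/4)) \<ge> 1/2"
    using factor by blast
  have \<delta>_pi: "\<delta> < pi" using \<delta> pi_gt3 by linarith
  have s: "sin \<delta> > 0" using \<delta> \<delta>_pi by (intro sin_gt_zero) auto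
  have x: "cos \<delta> \<ge> 1/2"
    using cos_monotone_0_pi_le[of \<delta> "pi/3"] \<delta> pi_gt3 by (simp add: cos_60)
  define r where "r = cmod (Complex (cos \<delta>) (sin \<delta>) - 1/4)"
  have r2: "r\<^sup>2 = 1 - cos \<delta> / 2 + 1/16"
    by (simp add: r_def cmod_power2 power2_diff power_divide cos_squared_eq)
  have r: "r > 0" using s by (auto simp: r_def complex_eq_iff)
  have c2: "(cmod (w - 1/4))\<^sup>2 = (cmod w)\<^sup>2 - Re w / 2 + 1/16" for w
    by (simp add: cmod_power2 power2_diff power_divide)
  define \<Omega> where "\<Omega> = ball (1/4 :: complex) r \<inter> ball 0 1"
  have op: "open \<Omega>" unfolding \<Omega>_def by (intro open_Int open_ball)
  show ?thesis
  proof (rule lens_lower_bound[OF f(2,4,5) x s, folded r_def])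
    show "cmod (Complex (cos \<delta>) (sin \<delta>)) \<le> 1" by (simp add: cmod_def)
    show "open \<Omega>" by fact
    show "\<Omega> \<subseteq> ball (1/4) r" by (simp add: \<Omega>_def)
    show "1/4 \<in> \<Omega>" using r by (simp add: \<Omega>_def)
    fix w assume w: "w \<in> frontier \<Omega>"
    have "closure \<Omega> \<subseteq> cball (1/4) r \<inter> cball 0 1"
      by (intro closure_minimal closed_Int closed_cball) (auto simp: \<Omega>_def)
    then have wr: "w \<in> cball (1/4) r" "cmod w \<le> 1" "w \<notin> \<Omega>"
      using w op by (auto simp: frontier_def interior_open)
    show "w \<in> ball (1/4) r \<and> cmod (f w) \<le> \<epsilon> \<or> w \<in> sphere (1/4) r \<and> Re w \<le> cos \<delta>"
    proof (cases "w \<in> ball (1/4) r")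
      case True
      then have w1: "cmod w = 1" using wr by (auto simp: \<Omega>_def)
      have "(cmod (w - 1/4))\<^sup>2 < r\<^sup>2"
        using True by (intro power_strict_mono) (auto simp: dist_norm norm_minus_commute)
      then have "cos \<delta> < Re w" unfolding c2 r2 using w1 by simp
      moreover have wA: "w = cis (Arg w)" using w1 cis_Arg[of w] by (cases "w = 0") (auto simp: sgn_div_norm)
      then have "Re w = cos \<bar>Arg w\<bar>" by (metis cis.simps(1) cos_abs_real)
      moreover have "\<bar>Arg w\<bar> \<le> pi" using mpi_less_Arg[of w] Arg_le_pi[of w] by linarith
      ultimately have "\<bar>Arg w\<bar> \<le> \<delta>"
        using cos_monotone_0_pi_le[of \<delta> "\<bar>Arg w\<bar>"] \<delta> by (cases "\<bar>Arg w\<bar> \<le> \<delta>") auto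
      then have "cmod (w ^ m * f w) \<le> \<epsilon>" using le[of "Arg w"] f(3)[of w] wA by simp
      then show ?thesis using True w1 by (simp add: norm_mult norm_power)
    next
      case False
      then have "cmod (w - 1/4) = r" using wr by (simp add: dist_norm norm_minus_commute)
      then have "(cmod w)\<^sup>2 - Re w / 2 + 1/16 = 1 - cos \<delta> / 2 + 1/16" using r2 c2 by metis
      moreover have "(cmod w)\<^sup>2 \<le> 1" using wr by (simp add: power_le_one)
      ultimately show ?thesis using wr False by auto
    qed
  qed
qed

end

subsection \<open>The disc of the negative binomial family\<close>

text \<open>Cauchy's inequality is applied to the Taylor coefficients at \<open>c\<close>: on the
  small circle below order \<open>m\<close>, on the large circle from \<open>m\<close> on. At half
  the large radius the tail is geometric; \<open>m\<close> stays free for balancing the two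
  terms.\<close>

lemma three_circles_taylor:
  fixes f :: "complex \<Rightarrow> complex" and R \<rho> :: real
  assumes holf: "f holomorphic_on UNIV" and \<rho>: "0 < \<rho>" "2 * \<rho> \<le> R"
    and small: "\<And>w. cmod (w - c) = \<rho> \<Longrightarrow> cmod (f w) \<le> \<epsilon>"
    and large: "\<And>w. cmod (w - c) = R \<Longrightarrow> cmod (f w) \<le> B"
    and z: "2 * cmod (z - c) \<le> R"
  shows "cmod (f z) \<le> (R / \<rho>) ^ m * \<epsilon> + 2 * B / 2 ^ m"
proof -
  define a where "a = (\<lambda>n. (deriv ^^ n) f c / fact n)"
  have R: "R > 0" using \<rho> by linarith
  have cont: "continuous_on S f" for S
    using holf holomorphic_on_imp_continuous_on continuous_on_subset by blast
  have hol: "f holomorphic_on S" for S using holf holomorphic_on_subset by blast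
  have coeff: "cmod (a n) \<le> b / r ^ n" if "r > 0" "\<And>w. cmod (w - c) = r \<Longrightarrow> cmod (f w) \<le> b" for n b r
    using Cauchy_inequality[of f c r b n] hol cont that
    by (simp add: a_def norm_divide norm_minus_commute field_simps)
  have \<epsilon>: "\<epsilon> \<ge> 0" using order_trans[OF norm_ge_zero coeff[OF \<rho>(1) small, of 0]] by simp
  have B: "B \<ge> 0" using order_trans[OF norm_ge_zero coeff[OF R large, of 0]] by simp
  have "(\<lambda>n. a n * (z - c) ^ n) sums f z"
    unfolding a_def
    by (rule holomorphic_power_series[where r = R]) (use hol z R in \<open>auto simp: dist_norm norm_minus_commute\<close>)
  then have sums: "(\<lambda>n. a (n + m) * (z - c) ^ (n + m)) sums (f z - (\<Sum>n<m. a n * (z - c) ^ n))"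
    by (subst sums_iff_shift) simp
  have "cmod (f z - (\<Sum>n<m. a n * (z - c) ^ n)) \<le> 2 * B / 2 ^ m"
  proof -
    have g: "(\<lambda>n. B / 2 ^ m * (1/2) ^ n) sums (B / 2 ^ m * 2)"
      using geometric_sums[of "1/2 :: real"] by (intro sums_mult) simp
    have term_le: "cmod (a (n + m) * (z - c) ^ (n + m)) \<le> B / 2 ^ m * (1/2) ^ n" for n
    proof -
      have "cmod (a (n + m) * (z - c) ^ (n + m)) \<le> B / R ^ (n + m) * (R / 2) ^ (n + m)"
        unfolding norm_mult norm_power using B R z
        by (intro mult_mono coeff[OF R large] power_mono) auto
      also have "\<dots> = B / 2 ^ m * (1/2) ^ n" using R by (simp add: power_divide power_add)
      finally show ?thesis .
    qed
    have "cmod (\<Sum>n. a (n + m) * (z - c) ^ (n + m)) \<le> (\<Sum>n. B / 2 ^ m * (1/2) ^ n)"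
      by (rule norm_suminf_le[OF term_le sums_summable[OF g]])
    then show ?thesis using sums_unique[OF sums] sums_unique[OF g] by (simp add: mult.commute)
  qed
  moreover have "cmod (\<Sum>n<m. a n * (z - c) ^ n) \<le> (R / \<rho>) ^ m * \<epsilon>"
  proof -
    define q where "q = R / (2 * \<rho>)"
    have q: "q \<ge> 1" using \<rho> by (simp add: q_def)
    have "cmod (\<Sum>n<m. a n * (z - c) ^ n) \<le> (\<Sum>n<m. \<epsilon> * q ^ m)"
    proof (rule sum_norm_le)
      fix n assume n: "n \<in> {..<m}"
      have "cmod (a n * (z - c) ^ n) \<le> \<epsilon> / \<rho> ^ n * (R / 2) ^ n"
        unfolding norm_mult norm_power using \<epsilon> \<rho> z
        by (intro mult_mono coeff[OF \<rho>(1) small] power_mono) auto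
      also have "\<dots> = \<epsilon> * q ^ n" by (simp add: q_def power_divide power_mult_distrib)
      also have "\<dots> \<le> \<epsilon> * q ^ m" using q n \<epsilon> by (intro mult_left_mono power_increasing) auto
      finally show "cmod (a n * (z - c) ^ n) \<le> \<epsilon> * q ^ m" .
    qed
    also have "\<dots> = real m * (\<epsilon> * q ^ m)" by simp
    \<comment> \<open>The number of terms is swallowed by \<open>2 ^ m\<close>, which also removes
      the factor 2 from the denominator of \<open>q\<close>.\<close>
    also have "\<dots> \<le> 2 ^ m * (\<epsilon> * q ^ m)"
      using \<epsilon> q of_nat_less_two_power[of m, where 'a = real] by (intro mult_right_mono) auto
    also have "\<dots> = (R / \<rho>) ^ m * \<epsilon>" by (simp add: q_def power_divide power_mult_distrib)
    finally show ?thesis .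
  qed
  ultimately show ?thesis
    using norm_triangle_sub[of "f z" "\<Sum>n<m. a n * (z - c) ^ n"] by linarith
qed

context unit_coeffs
begin

lemma norm_poly_le:
  assumes "cmod w \<le> t" "t \<ge> 1"
  shows "cmod (\<Sum>j\<le>N. e j * w ^ j) \<le> (real N + 1) * t ^ N"
proof -
  have "cmod (\<Sum>j\<le>N. e j * w ^ j) \<le> (\<Sum>j\<le>N. t ^ N)"
  proof (rule sum_norm_le)
    fix j assume j: "j \<in> {..N}"
    have "cmod (e j * w ^ j) \<le> 1 * t ^ j"
      unfolding norm_mult norm_power using assms by (intro mult_mono norm_coeff_le power_mono) auto
    also have "\<dots> \<le> t ^ N" using j assms by (simp add: power_increasing)
    finally show "cmod (e j * w ^ j) \<le> t ^ N" .
  qed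
  then show ?thesis by (simp add: algebra_simps)
qed

section \<open>Choice of the chord for the Poisson, chi-squared and negative binomial
  families\<close>

text \<open>On these chords of depth \<open>2 * s\<^sup>2\<close> the Poisson and chi-squared test
  functions are bounded by 1. With \<open>s = 1 / (5 * t)\<close> and \<open>t ^ 3 = N\<close> the
  cost \<open>40 / s\<close> is \<open>200 * t\<close> and the degree costs \<open>4/25 * t\<close>,
  so both are of order \<open>t\<close>.\<close>

lemma narrow_chord_lower_bound:
  fixes t \<epsilon> :: real
  defines "t \<equiv> root 3 (real N)"
  assumes N: "N \<ge> 1"
    and le: "\<And>w s. 0 < s \<Longrightarrow> s \<le> 1/5 \<Longrightarrow> Re w = 1 - 2 * s\<^sup>2 \<Longrightarrow> \<bar>Im w\<bar> \<le> s \<Longrightarrow>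
               cmod (\<Sum>j\<le>N. e j * w ^ j) \<le> \<epsilon>"
  shows "\<epsilon> \<ge> exp (- 201 * t)"
proof -
  have t: "t \<ge> 1" "t ^ 3 = real N" using N by (auto simp: t_def)
  define s where "s = 1 / (5 * t)"
  have s: "0 < s" "s \<le> 1/5" using t by (auto simp: s_def field_simps)
  have s2: "s\<^sup>2 \<le> 1/25" using power_mono[OF s(2), of 2] s by (simp add: power_divide)
  have "\<epsilon> \<ge> exp (- 40 / s - 2 * 2 * real N * s\<^sup>2)"
    using le[OF s] s s2 by (intro chord_lower_bound) auto
  also have "- 40 / s - 2 * 2 * real N * s\<^sup>2 = - (200 + 4/25) * t"
    using t(1) unfolding t(2)[symmetric] by (simp add: s_def power2_eq_square power3_eq_cube field_simps)
  finally have "\<epsilon> \<ge> exp (- (200 + 4/25) * t)" .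
  moreover have "exp (- (200 + 4/25) * t) \<ge> exp (- 201 * t)" using t by simp
  ultimately show ?thesis by linarith
qed

text \<open>The condition on \<open>w\<close> describes the disc with centre
  \<open>1 / (1 + p)\<close> and radius \<open>p / (1 + p)\<close>, which touches the unit circle at
  1. A chord of depth \<open>2 / p * s\<^sup>2\<close> fits into it if \<open>s \<le> p / 2\<close>,
  and \<open>Np\<close> guarantees this for the balanced choice
  \<open>s = 1 / (2 * t)\<close>.\<close>

lemma disc_lower_bound_large:
  fixes p t \<epsilon> :: real
  defines "t \<equiv> root 3 (real N / p)"
  assumes p: "0 < p" "p < 1" and Np: "1 \<le> real N * p\<^sup>2"
    and le: "\<And>w. cmod (w - of_real (1 - p)) \<le> p * cmod w \<Longrightarrow> cmod (\<Sum>j\<le>N. e j * w ^ j) \<le> \<epsilon>"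
  shows "\<epsilon> \<ge> exp (- 81 * t)"
proof -
  have t3: "t ^ 3 = real N / p" using p by (simp add: t_def)
  have "t \<ge> 1 / p"
  proof -
    have "(1 / p) ^ 3 \<le> real N / p"
      using Np p by (simp add: power3_eq_cube power2_eq_square field_simps)
    moreover have "t \<ge> 0" using p by (simp add: t_def)
    ultimately show ?thesis using p power_mono_iff[of "1 / p" t 3] by (simp add: t3)
  qed
  moreover have "1 / p > 1" using p by simp
  ultimately have t: "t \<ge> 1 / p" "t > 1" by auto
  define s where "s = 1 / (2 * t)"
  have s: "0 < s" "s \<le> p / 2" using t p by (auto simp: s_def field_simps)
  have s2: "s\<^sup>2 \<le> p\<^sup>2 / 4" using power_mono[OF s(2), of 2] s by (simp add: power_divide)
  have K: "2 / p * s\<^sup>2 \<le> p / 2" 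
    using s2 p by (simp add: field_simps power2_eq_square)
  have "\<epsilon> \<ge> exp (- 40 / s - 2 * (2 / p) * real N * s\<^sup>2)"
  proof (rule chord_lower_bound)
    show "s > 0" by fact
    show "1 \<le> 2 / p" using p by simp
    show "2 / p * s\<^sup>2 \<le> 1/2" by (rule order_trans[OF K]) (use p in simp)
    fix w assume w: "Re w = 1 - 2 / p * s\<^sup>2" "\<bar>Im w\<bar> \<le> s"
    define h where "h = 2 / p * s\<^sup>2"
    have h: "0 \<le> h" "h \<le> p / 2" "p * h = 2 * s\<^sup>2" using K p by (auto simp: h_def)
    have "(Im w)\<^sup>2 \<le> s\<^sup>2" using w(2) s abs_le_square_iff[of "Im w" s] by simp
    moreover have "h\<^sup>2 \<le> p * h / 2"
      unfolding power2_eq_square using mult_right_mono[OF h(2,1)] by simp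
    \<comment> \<open>In terms of \<open>h = 1 - Re w\<close> the disc is given by \<open>(1 -
      p\<^sup>2) * (h\<^sup>2 + (Im w)\<^sup>2) \<le> 2 * (1 - p) * (p * h)\<close>. Half of
      \<open>p * h\<close> pays for \<open>h\<^sup>2\<close>, the other half for
      \<open>(Im w)\<^sup>2\<close>.\<close>
    ultimately have "h\<^sup>2 + (Im w)\<^sup>2 \<le> p * h" using h(3) by linarith
    then have "(1 - p\<^sup>2) * (h\<^sup>2 + (Im w)\<^sup>2) \<le> (1 - p\<^sup>2) * (p * h)"
      using p by (intro mult_left_mono) (auto simp: power_le_one)
    also have "\<dots> \<le> 2 * (1 - p) * (p * h)"
      using p h by (intro mult_right_mono) (auto simp: power2_eq_square algebra_simps, sos)
    finally have "(1 - p\<^sup>2) * (h\<^sup>2 + (Im w)\<^sup>2) \<le> 2 * (1 - p) * (p * h)" .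
    then have "(p - h)\<^sup>2 + (Im w)\<^sup>2 \<le> p\<^sup>2 * ((1 - h)\<^sup>2 + (Im w)\<^sup>2)"
      by (simp add: power2_eq_square algebra_simps)
    moreover have "Re w = 1 - h" using w by (simp add: h_def)
    ultimately have "(cmod (w - of_real (1 - p)))\<^sup>2 \<le> (p * cmod w)\<^sup>2"
      by (simp add: cmod_power2 power_mult_distrib)
    then have "cmod (w - of_real (1 - p)) \<le> p * cmod w"
      by (rule power2_le_imp_le) (use p in auto)
    then show "cmod (\<Sum>j\<le>N. e j * w ^ j) \<le> \<epsilon>" by (rule le)
  qed
  also have "- 40 / s - 2 * (2 / p) * real N * s\<^sup>2 = - 80 * t - (real N / p) / t\<^sup>2"
    using t p by (simp add: s_def field_simps power2_eq_square)
  also have "\<dots> = - 81 * t"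
    unfolding t3[symmetric] using t by (simp add: power2_eq_square power3_eq_cube)
  finally show ?thesis .
qed

text \<open>A chord of half-width \<open>1 / (2 * sqrt N)\<close>, for which the degree costs only a
  constant factor, leaves the admissible disc. If the polynomial were tiny on the circle bounding
  that disc, its growth on a larger circle would keep it too small on the chord.\<close>

lemma disc_lower_bound_small:
  fixes p t \<epsilon> :: real
  defines "t \<equiv> root 3 (real N / p)"
  assumes N: "N \<ge> 1" and p: "0 < p" "p < 1" and Np: "real N * p\<^sup>2 \<le> 1"
    and le: "\<And>w. cmod (w - of_real (1 - p)) \<le> p * cmod w \<Longrightarrow> cmod (\<Sum>j\<le>N. e j * w ^ j) \<le> \<epsilon>"
  shows "\<epsilon> \<ge> exp (- 1200 * t)"
proof -
  define n where "n = sqrt (real N)"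
  have n: "n \<ge> 1" "n\<^sup>2 = real N" using N by (auto simp: n_def)
  have np: "p * n \<le> 1"
  proof -
    have "(p * n)\<^sup>2 \<le> 1\<^sup>2" using Np by (simp add: power_mult_distrib n mult.commute)
    then show ?thesis by (rule power2_le_imp_le) simp
  qed
  define y where "y = t / n"
  have t0: "t > 0" using p N by (simp add: t_def)
  have t3: "t ^ 3 = real N / p" using p by (simp add: t_def)
  have y3: "y ^ 3 = 1 / (p * n)"
  proof -
    have "y ^ 3 = (n\<^sup>2 / p) / n ^ 3" by (simp add: y_def power_divide t3 n)
    then show ?thesis using n(1) p by (simp add: power2_eq_square power3_eq_cube)
  qed
  have y: "y \<ge> 1"
  proof -
    have "1 ^ 3 \<le> y ^ 3" unfolding y3 using np p n(1) by simp
    moreover have "0 \<le> y" using t0 n(1) by (simp add: y_def)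
    ultimately show ?thesis using power_mono_iff[of 1 y 3] by simp
  qed
  \<comment> \<open>\<open>c\<close> and \<open>\<rho>\<close> are the centre and radius of the
    admissible disc. \<open>R\<close> is large enough for the chord to lie within
    \<open>R / 2\<close> of \<open>c\<close>, and small enough for the polynomial to be at most
    \<open>exp (6 * n)\<close> at distance \<open>R\<close>.\<close>
  define c where "c = 1 / (1 + p)"
  define \<rho> where "\<rho> = p / (1 + p)"
  define R where "R = 4 / n"
  \<comment> \<open>This order makes the Taylor tail at most half of the chord bound:
    \<open>2 ^ m \<ge> exp (m / 2) \<ge> exp (89 * n)\<close> exceeds
    \<open>4 * exp (86 * n + 1/2)\<close>.\<close>
  define m where "m = nat \<lceil>178 * n\<rceil>"
  have "real m = of_int \<lceil>178 * n\<rceil>" using n(1) by (simp add: m_def)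
  then have m: "178 * n \<le> real m" "real m \<le> 179 * n"
    using n(1) le_of_int_ceiling[of "178 * n"] of_int_ceiling_le_add_one[of "178 * n"] by linarith+
  have \<rho>: "0 < \<rho>" "\<rho> \<le> p" "1 - c = \<rho>" using p by (auto simp: \<rho>_def c_def field_simps)
  have pn: "p \<le> 1 / n" using np n(1) by (simp add: field_simps)
  have bound: "cmod (\<Sum>j\<le>N. e j * z ^ j) \<le> (R / \<rho>) ^ m * \<epsilon> + 2 * exp (6 * n) / 2 ^ m"
    if "Re z = 1 - 1 * (1 / (2 * n))\<^sup>2" "\<bar>Im z\<bar> \<le> 1 / (2 * n)" for z
  proof (rule three_circles_taylor[where f = "\<lambda>z. \<Sum>j\<le>N. e j * z ^ j" and c = "of_real c"])
    show "(\<lambda>z. \<Sum>j\<le>N. e j * z ^ j) holomorphic_on UNIV" by (intro holomorphic_intros)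
    show "0 < \<rho>" by fact
    show "2 * \<rho> \<le> R" using \<rho> pn n(1) unfolding R_def by linarith
    show "2 * cmod (z - of_real c) \<le> R"
    proof -
      have "(1 / (2 * n))\<^sup>2 \<le> 1 / (2 * n) * 1"
        unfolding power2_eq_square using n(1) by (intro mult_left_mono) auto
      then have "\<bar>Re (z - 1)\<bar> \<le> 1 / (2 * n)" using that by simp
      moreover have "\<bar>Im (z - 1)\<bar> \<le> 1 / (2 * n)" using that by simp
      moreover have "1 / (2 * n) + 1 / (2 * n) = 1 / n" by simp
      ultimately have "cmod (z - 1) \<le> 1 / n"
        using cmod_le[of "z - 1"] by linarith
      moreover have "1 - complex_of_real c = of_real \<rho>"
        unfolding \<rho>(3)[symmetric] by simp
      then have "cmod (1 - of_real c) \<le> 1 / n" using \<rho>(1,2) pn by simp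
      ultimately show ?thesis
        using norm_triangle_ineq[of "z - 1" "1 - of_real c"] by (simp add: R_def)
    qed
  next
    fix w assume w: "cmod (w - of_real c) = \<rho>"
    have "(Re w - c)\<^sup>2 + (Im w)\<^sup>2 = \<rho>\<^sup>2"
      using arg_cong[OF w, of "\<lambda>u. u\<^sup>2"] by (simp add: cmod_power2)
    moreover have "c * (1 + p) = 1" using p by (simp add: c_def)
    ultimately have "(1 + p) * (cmod w)\<^sup>2 - 2 * Re w + (1 - p) = 0"
      using \<rho>(3) unfolding cmod_power2 by algebra
    then have "(1 - p) * ((1 + p) * (cmod w)\<^sup>2 - 2 * Re w + (1 - p)) = 0" by simp
    then have "(cmod (w - of_real (1 - p)))\<^sup>2 = (p * cmod w)\<^sup>2"
      unfolding power_mult_distrib cmod_power2 by (simp add: algebra_simps power2_eq_square)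
    then have "cmod (w - of_real (1 - p)) = p * cmod w"
      by (rule power2_eq_imp_eq) (use p in auto)
    then show "cmod (\<Sum>j\<le>N. e j * w ^ j) \<le> \<epsilon>" by (intro le) simp
  next
    fix w assume w: "cmod (w - of_real c) = R"
    have "cmod w \<le> 1 + 4 / n"
    proof -
      have "\<bar>c\<bar> \<le> 1" using p by (simp add: c_def)
      then show ?thesis using norm_triangle_sub[of w "of_real c"] w by (simp add: R_def)
    qed
    then have "cmod (\<Sum>j\<le>N. e j * w ^ j) \<le> (real N + 1) * (1 + 4 / n) ^ N"
      using n(1) by (intro norm_poly_le) auto
    also have "\<dots> \<le> exp (2 * n) * exp (4 * n)"
    proof (rule mult_mono)
      have "n\<^sup>2 + 1 \<le> (1 + n)\<^sup>2" using n(1) by (simp add: power2_eq_square algebra_simps)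
      also have "\<dots> \<le> (exp n)\<^sup>2" using n(1) exp_ge_add_one_self[of n] by (intro power_mono) auto
      finally show "real N + 1 \<le> exp (2 * n)" by (simp add: n exp_double)
      have "(1 + 4 / n) ^ N \<le> exp (4 / n) ^ N" 
        using n(1) by (intro power_mono exp_ge_add_one_self) auto
      also have "\<dots> = exp (n\<^sup>2 * (4 / n))" unfolding n(2) by (rule exp_of_nat_mult[symmetric])
      finally show "(1 + 4 / n) ^ N \<le> exp (4 * n)"
        using n(1) by (simp add: power2_eq_square mult.commute)
    qed (use n(1) in auto)
    also have "\<dots> = exp (6 * n)" by (simp add: exp_add[symmetric])
    finally show "cmod (\<Sum>j\<le>N. e j * w ^ j) \<le> exp (6 * n)" .
  qed
  have "(R / \<rho>) ^ m * \<epsilon> + 2 * exp (6 * n) / 2 ^ m \<ge> exp (- 40 / (1 / (2 * n)) - 2 * 1 * real N * (1 / (2 * n))\<^sup>2)"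
  proof (rule chord_lower_bound)
    have "(1 / (2 * n))\<^sup>2 \<le> 1 / 4"
      using n(1) N by (simp add: power_divide power_mult_distrib n(2) field_simps)
    then show "1 * (1 / (2 * n))\<^sup>2 \<le> 1 / 2" by simp
  qed (use n(1) bound in auto)
  also have "- 40 / (1 / (2 * n)) - 2 * 1 * real N * (1 / (2 * n))\<^sup>2 = - 80 * n - 1/2"
    using n(1) by (simp add: n(2)[symmetric] power_divide power_mult_distrib)
  finally have main: "exp (- 80 * n - 1/2) \<le> (R / \<rho>) ^ m * \<epsilon> + 2 * exp (6 * n) / 2 ^ m" .
  have e1: "exp (1/2 :: real) \<le> 2"
  proof (rule power2_le_imp_le)
    show "(exp (1/2 :: real))\<^sup>2 \<le> 2\<^sup>2" using exp_le by (simp add: exp_double[symmetric])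
  qed simp
  have "2 * exp (6 * n) / 2 ^ m \<le> exp (- 80 * n - 1/2) / 2"
  proof -
    have "4 \<le> exp (2 :: real)"
      using power_mono[of 2 "exp 1 :: real" 2] exp_ge_add_one_self[of 1] by (simp add: exp_double[symmetric])
    then have "4 * exp (86 * n + 1/2) \<le> exp 2 * exp (86 * n + 1/2)" by (intro mult_right_mono) auto
    also have "\<dots> = exp (86 * n + 5/2)" by (simp add: exp_add[symmetric])
    also have "\<dots> \<le> exp (real m * (1/2))" using m n(1) by simp
    also have "\<dots> = exp (1/2) ^ m" by (rule exp_of_nat_mult)
    also have "\<dots> \<le> 2 ^ m" using e1 by (intro power_mono) auto
    finally have "4 * exp (86 * n + 1/2) \<le> 2 ^ m" .
    then have "4 * exp (86 * n + 1/2) * exp (- 80 * n - 1/2) \<le> 2 ^ m * exp (- 80 * n - 1/2)"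
      by (intro mult_right_mono) auto
    then have "4 * exp (6 * n) \<le> 2 ^ m * exp (- 80 * n - 1/2)"
      by (simp add: mult.assoc exp_add[symmetric])
    then show ?thesis by (simp add: field_simps)
  qed
  with main have "exp (- 80 * n - 1/2) / 2 \<le> (R / \<rho>) ^ m * \<epsilon>" by linarith
  moreover have "exp (- 82 * n) \<le> exp (- 80 * n - 1/2) / 2"
  proof -
    have "2 * exp (- 82 * n) \<le> exp 1 * exp (- 82 * n)"
      using exp_ge_add_one_self[of 1] by (intro mult_right_mono) auto
    also have "\<dots> \<le> exp (- 80 * n - 1/2)" using n(1) by (simp add: exp_add[symmetric])
    finally show ?thesis by simp
  qed
  ultimately have low: "exp (- 82 * n) \<le> (R / \<rho>) ^ m * \<epsilon>" by linarith
  \<comment> \<open>The ratio is of order \<open>y ^ 3\<close>. Replacing its logarithm by a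
    multiple of \<open>y\<close> is affordable, because \<open>m\<close> is of order
    \<open>n\<close> and \<open>n * y = t\<close> is the exponent aimed at.\<close>
  have "R / \<rho> \<le> exp (6 * y)"
  proof -
    have "R / \<rho> = 4 * (1 + p) * y ^ 3" using n(1) p by (simp add: R_def \<rho>_def y3)
    also have "\<dots> \<le> 8 * y ^ 3" using p y by (intro mult_right_mono) auto
    also have "\<dots> = (2 * y) ^ 3" by (simp add: power_mult_distrib)
    also have "\<dots> \<le> exp (2 * y) ^ 3"
    proof (rule power_mono)
      show "2 * y \<le> exp (2 * y)" using exp_ge_add_one_self[of "2 * y"] by linarith
    qed (use y in auto)
    also have "\<dots> = exp (6 * y)" by (simp add: exp_of_nat_mult[symmetric])
    finally show ?thesis .
  qed
  moreover have "0 \<le> R / \<rho>" using \<rho> n(1) by (simp add: R_def)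
  ultimately have "(R / \<rho>) ^ m \<le> exp (6 * y) ^ m" by (intro power_mono)
  also have "\<dots> = exp (real m * (6 * y))" by (rule exp_of_nat_mult[symmetric])
  also have "\<dots> \<le> exp (179 * n * (6 * y))" using m y by (simp add: mult_right_mono)
  finally have pw: "(R / \<rho>) ^ m \<le> exp (1074 * (n * y))" by (simp add: mult_ac)
  have \<epsilon>: "\<epsilon> \<ge> 0"
  proof -
    have "cmod (1 - of_real (1 - p)) \<le> p * cmod 1"
      using p by simp
    then show ?thesis using le[of 1] norm_ge_zero order_trans by blast
  qed
  have "exp (- 82 * n) \<le> exp (1074 * (n * y)) * \<epsilon>"
    using low mult_right_mono[OF pw \<epsilon>] by linarith
  then have "exp (- 82 * n) * exp (- 1074 * (n * y)) \<le> (exp (1074 * (n * y)) * \<epsilon>) * exp (- 1074 * (n * y))"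
    by (intro mult_right_mono) auto
  then have "exp (- 82 * n - 1074 * (n * y)) \<le> \<epsilon>"
    by (simp add: exp_diff exp_minus field_simps)
  moreover have "n * y = t" using n(1) by (simp add: y_def)
  moreover have "n \<le> n * y" using n(1) y by simp
  then have "exp (- 1200 * t) \<le> exp (- 82 * n - 1074 * (n * y))"
    using \<open>n * y = t\<close> t0 by simp
  ultimately show ?thesis by linarith
qed

end

subsection \<open>Test functions and transforms\<close>

text \<open>Duality: a test function bounded by 1, integrated against the difference of the
  mixtures, gives at most their \<open>L1\<close> distance. The factor 2 undoes the 1/2 in
  \<open>tv_dist\<close>, and \<open>k\<close> undoes the averaging.\<close>

lemma tv_dist_mixture_ge:
  fixes h :: "'a \<Rightarrow> complex"
  assumes h: "h \<in> borel_measurable B" "\<And>x. cmod (h x) \<le> 1" and k: "k \<ge> 1"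
    and f: "\<And>i. i \<in> {1..k} \<Longrightarrow> integrable B (f i)" and g: "\<And>i. i \<in> {1..k} \<Longrightarrow> integrable B (g i)"
  shows "cmod ((\<Sum>i=1..k. \<integral>x. h x * of_real (f i x) \<partial>B) - (\<Sum>i=1..k. \<integral>x. h x * of_real (g i x) \<partial>B))
           \<le> 2 * real k * tv_dist B (mixture k f) (mixture k g)"
proof -
  have int: "integrable B (\<lambda>x. h x * complex_of_real (u x))" if "integrable B u" for u
  proof (rule Bochner_Integration.integrable_bound[OF that])
    show "(\<lambda>x. h x * complex_of_real (u x)) \<in> borel_measurable B"
      using h(1) borel_measurable_integrable[OF that] by measurable
    show "AE x in B. norm (h x * complex_of_real (u x)) \<le> norm (u x)"
      using h(2) by (intro AE_I2) (auto simp: norm_mult intro!: mult_left_le_one_le)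
  qed
  have mix: "integrable B (mixture k u)" if "\<And>i. i \<in> {1..k} \<Longrightarrow> integrable B (u i)" for u
    unfolding mixture_def using that by (intro integrable_mult_right Bochner_Integration.integrable_sum) auto
  have sum_eq: "(\<Sum>i=1..k. \<integral>x. h x * of_real (u i x) \<partial>B) = of_nat k * (\<integral>x. h x * of_real (mixture k u x) \<partial>B)"
    if "\<And>i. i \<in> {1..k} \<Longrightarrow> integrable B (u i)" for u
  proof -
    have "of_nat k * (\<integral>x. h x * of_real (mixture k u x) \<partial>B) = 
            (\<integral>x. of_nat k * (h x * of_real (mixture k u x)) \<partial>B)"
      by simp
    also have "\<dots> = (\<integral>x. (\<Sum>i=1..k. h x * of_real (u i x)) \<partial>B)"
      using k by (intro Bochner_Integration.integral_cong) (auto simp: mixture_def sum_distrib_left)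
    also have "\<dots> = (\<Sum>i=1..k. \<integral>x. h x * of_real (u i x) \<partial>B)"
      using that int by (intro Bochner_Integration.integral_sum) auto
    finally show ?thesis ..
  qed
  let ?d = "\<lambda>x. mixture k f x - mixture k g x"
  have intd: "integrable B ?d" using mix[OF f] mix[OF g] by (intro Bochner_Integration.integrable_diff)
  have "(\<Sum>i=1..k. \<integral>x. h x * of_real (f i x) \<partial>B) - (\<Sum>i=1..k. \<integral>x. h x * of_real (g i x) \<partial>B) =
          of_nat k * ((\<integral>x. h x * of_real (mixture k f x) \<partial>B) - (\<integral>x. h x * of_real (mixture k g x) \<partial>B))"
    by (simp only: sum_eq[of f, OF f] sum_eq[of g, OF g] right_diff_distrib)
  also have "\<dots> = of_nat k * (\<integral>x. h x * of_real (?d x) \<partial>B)"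
    using int[OF mix[OF f]] int[OF mix[OF g]] by (simp add: algebra_simps)
  finally have "cmod ((\<Sum>i=1..k. \<integral>x. h x * of_real (f i x) \<partial>B) - (\<Sum>i=1..k. \<integral>x. h x * of_real (g i x) \<partial>B)) =
     real k * cmod (\<integral>x. h x * of_real (?d x) \<partial>B)"
    by (simp add: norm_mult)
  also have "cmod (\<integral>x. h x * of_real (?d x) \<partial>B) \<le> (\<integral>x. cmod (h x * of_real (?d x)) \<partial>B)"
    by (rule integral_norm_bound)
  also have "\<dots> \<le> (\<integral>x. \<bar>?d x\<bar> \<partial>B)"
  proof (rule integral_mono)
    show "integrable B (\<lambda>x. cmod (h x * of_real (?d x)))" using int[OF intd] by (rule integrable_norm)
    show "integrable B (\<lambda>x. \<bar>?d x\<bar>)" using intd by (rule integrable_abs)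
    show "cmod (h x * of_real (?d x)) \<le> \<bar>?d x\<bar>" for x
      using mult_right_mono[OF h(2)[of x], of "\<bar>?d x\<bar>"] unfolding norm_mult norm_of_real by simp
  qed
  finally show ?thesis using k by (simp add: tv_dist_def mult_left_mono)
qed

section \<open>Probability generating functions\<close>

lemma integrable_pmf_count_space: "integrable (count_space UNIV) (pmf p)"
  using integrable_pmf[of UNIV p] by simp

lemma sums_imp_integral_count_space:
  fixes f :: "nat \<Rightarrow> complex"
  assumes "f sums s" "summable (\<lambda>n. cmod (f n))"
  shows "(\<integral>x. f x \<partial>count_space UNIV) = s"
  using sums_integral_count_space_nat[of f] assms sums_unique2
  by (auto simp: integrable_count_space_nat_iff)

lemma pgf_sums_imp_integral:
  fixes q :: "nat pmf" and z :: complex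
  assumes "cmod z \<le> 1" "(\<lambda>n. z ^ n * of_real (pmf q n)) sums s"
  shows "(\<integral>n. z ^ n * of_real (pmf q n) \<partial>count_space UNIV) = s"
proof (rule sums_imp_integral_count_space[OF assms(2)])
  have "summable (pmf q)"
    using integrable_pmf_count_space[of q] by (simp add: integrable_count_space_nat_iff)
  then show "summable (\<lambda>n. cmod (z ^ n * of_real (pmf q n)))"
    using assms(1)
    by (elim summable_comparison_test'[where N = 0])
      (auto simp: norm_mult norm_power power_le_one intro!: mult_left_le_one_le)
qed

lemma Poi_pgf:
  assumes "cmod z \<le> 1"
  shows "(\<integral>n. z ^ n * of_real (pmf (Poi (real j)) n) \<partial>count_space UNIV) = exp (z - 1) ^ j"
proof (rule pgf_sums_imp_integral[OF assms])
  have "(\<lambda>n. exp (- of_nat j) * ((of_nat j * z) ^ n /\<^sub>R fact n)) sums (exp (- of_nat j) * exp (of_nat j * z))"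
    by (intro sums_mult exp_converges)
  also have "(\<lambda>n. exp (- of_nat j) * ((of_nat j * z) ^ n /\<^sub>R fact n)) = (\<lambda>n. z ^ n * of_real (pmf (Poi (real j)) n))"
  proof
    fix n
    have "exp (- of_nat j) = complex_of_real (exp (- real j))" by (simp add: exp_of_real[symmetric])
    then show "exp (- of_nat j) * ((of_nat j * z) ^ n /\<^sub>R fact n) = z ^ n * of_real (pmf (Poi (real j)) n)"
      by (simp add: pmf_Poi power_mult_distrib scaleR_conv_of_real field_simps)
  qed
  also have "exp (- of_nat j) * exp (of_nat j * z) = exp (z - 1) ^ j"
    by (simp add: exp_of_nat_mult[symmetric] exp_add[symmetric] algebra_simps)
  finally show "(\<lambda>n. z ^ n * of_real (pmf (Poi (real j)) n)) sums exp (z - 1) ^ j" .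
qed

lemma NB_pgf:
  assumes p: "0 < p" "p < 1" and z: "cmod z \<le> 1"
  shows "(\<integral>n. z ^ n * of_real (pmf (NB r p) n) \<partial>count_space UNIV) = (of_real (1 - p) / (1 - of_real p * z)) ^ r"
proof (rule pgf_sums_imp_integral[OF z])
  define u where "u = - (of_real p * z)"
  have "cmod u \<le> p" using p z by (simp add: u_def norm_mult mult_left_le)
  then have u: "cmod u < 1" using p by simp
  then have u1: "1 + u \<noteq> 0" by (metis add_eq_0_iff less_irrefl norm_minus_cancel norm_one)
  have "(\<lambda>n. of_real (1 - p) ^ r * ((- of_nat r gchoose n) * u ^ n)) sums (of_real (1 - p) ^ r * (1 + u) powr (- of_nat r))"
    by (intro sums_mult gen_binomial_complex u)
  also have "(1 + u) powr (- of_nat r) = inverse ((1 + u) ^ r)"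
    using u1 by (simp add: powr_minus powr_nat')
  also have "(\<lambda>n. of_real (1 - p) ^ r * ((- of_nat r gchoose n) * u ^ n)) = (\<lambda>n. z ^ n * of_real (pmf (NB r p) n))"
  proof
    fix n
    have "pmf (NB r p) n = (-1) ^ n * ((-real r) gchoose n) * (1 - p) ^ r * p ^ n"
      using p by (simp add: NB_def pmf_neg_binomial')
    moreover have "complex_of_real ((-real r) gchoose n) = (- of_nat r gchoose n)"
      by (simp add: gbinomial_prod_rev)
    ultimately show "of_real (1 - p) ^ r * ((- of_nat r gchoose n) * u ^ n) = z ^ n * of_real (pmf (NB r p) n)"
      by (simp add: u_def power_mult_distrib power_minus[of "of_real p * z"])
  qed
  finally show "(\<lambda>n. z ^ n * of_real (pmf (NB r p) n)) sums (of_real (1 - p) / (1 - of_real p * z)) ^ r"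
    by (simp add: u_def power_divide field_simps)
qed

section \<open>Fourier transform of the Gaussian and Laplace transform of chi-squared\<close>

lemma normal_density_fourier:
  assumes "\<sigma> > 0"
  shows "(\<integral>x. cis (t * x) * of_real (normal_density \<mu> \<sigma> x) \<partial>lborel) = of_real (exp (- (\<sigma> * t)\<^sup>2 / 2)) * cis (t * \<mu>)"
proof -
  have std: "(\<integral>x. cis (u * x) * of_real (std_normal_density x) \<partial>lborel) = of_real (exp (- u\<^sup>2 / 2))" for u
  proof -
    have "(\<integral>x. cis (u * x) * of_real (std_normal_density x) \<partial>lborel) = (\<integral>x. std_normal_density x *\<^sub>R iexp (u * x) \<partial>lborel)"
      by (intro Bochner_Integration.integral_cong) (auto simp: cis_conv_exp scaleR_conv_of_real mult.commute)
    also have "\<dots> = char std_normal_distribution u"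
      unfolding char_def by (subst integral_density) auto
    finally show ?thesis by (simp add: char_std_normal_distribution)
  qed
  have "(\<integral>x. cis (t * x) * of_real (normal_density \<mu> \<sigma> x) \<partial>lborel) =
          \<bar>\<sigma>\<bar> *\<^sub>R (\<integral>x. cis (t * (\<mu> + \<sigma> * x)) * of_real (normal_density \<mu> \<sigma> (\<mu> + \<sigma> * x)) \<partial>lborel)"
    using assms by (intro lborel_integral_real_affine) auto
  also have "\<dots> = (\<integral>x. \<sigma> *\<^sub>R (cis (t * (\<mu> + \<sigma> * x)) * of_real (normal_density \<mu> \<sigma> (\<mu> + \<sigma> * x))) \<partial>lborel)"
    using assms by simp
  also have "\<dots> = (\<integral>x. cis (t * \<mu>) * (cis ((\<sigma> * t) * x) * of_real (std_normal_density x)) \<partial>lborel)"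
  proof (intro Bochner_Integration.integral_cong refl)
    fix x
    have "normal_density \<mu> \<sigma> (\<mu> + \<sigma> * x) = std_normal_density x / \<sigma>"
      using assms by (simp add: normal_density_def real_sqrt_mult power_mult_distrib field_simps)
    moreover have "cis (t * (\<mu> + \<sigma> * x)) = cis (t * \<mu>) * cis ((\<sigma> * t) * x)"
      by (simp add: cis_mult algebra_simps)
    ultimately show "\<sigma> *\<^sub>R (cis (t * (\<mu> + \<sigma> * x)) * of_real (normal_density \<mu> \<sigma> (\<mu> + \<sigma> * x))) =
        cis (t * \<mu>) * (cis ((\<sigma> * t) * x) * of_real (std_normal_density x))"
      using assms by (simp add: scaleR_conv_of_real)
  qed
  also have "\<dots> = cis (t * \<mu>) * of_real (exp (- (\<sigma> * t)\<^sup>2 / 2))" by (simp add: std)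
  finally show ?thesis by (simp add: mult.commute)
qed

lemma chi_squared_density_nonneg:
  "0 \<le> chi_squared_density l x"
  by (cases "l = 0") (auto simp: chi_squared_density_def intro!: divide_nonneg_nonneg mult_nonneg_nonneg less_imp_le[OF Gamma_real_pos])

text \<open>Halving the variable turns the moment into the Gamma integral at
  \<open>l / 2 + n\<close>. The case \<open>n = 0\<close> provides integrability of the density
  itself.\<close>

lemma chi_squared_moment:
  assumes "l \<ge> 1"
  shows "has_bochner_integral lborel (\<lambda>x. x ^ n * chi_squared_density l x) (2 ^ n * pochhammer (real l / 2) n)"
proof -
  define \<alpha> where "\<alpha> = real l / 2"
  define \<beta> where "\<beta> = \<alpha> + real n"
  have pos: "\<alpha> > 0" "\<beta> > 0" using assms by (auto simp: \<alpha>_def \<beta>_def)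
  have G: "Gamma \<alpha> > 0" "Gamma \<beta> > 0" using pos by (auto intro: Gamma_real_pos)
  have "has_bochner_integral lborel (\<lambda>t. indicator {0..} t * (t powr (\<beta> - 1) / exp t)) (Gamma \<beta>)"
  proof (rule has_bochner_integral_nn_integral)
    show "(\<integral>\<^sup>+t. ennreal (indicator {0..} t * (t powr (\<beta> - 1) / exp t)) \<partial>lborel) = ennreal (Gamma \<beta>)"
      using nn_integral_has_integral_lebesgue[OF _ Gamma_integral_real[OF pos(2)]] by auto
  qed (use G in auto)
  then have "has_bochner_integral lborel (\<lambda>x. indicator {0..} (0 + 1/2 * x) * ((0 + 1/2 * x) powr (\<beta> - 1) / exp (0 + 1/2 * x)))
      (Gamma \<beta> /\<^sub>R \<bar>1/2\<bar>)"
    by (subst lborel_has_bochner_integral_real_affine_iff[symmetric]) auto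
  then have "has_bochner_integral lborel (\<lambda>x. 2 ^ n / (2 * Gamma \<alpha>) *
      (indicator {0..} (0 + 1/2 * x) * ((0 + 1/2 * x) powr (\<beta> - 1) / exp (0 + 1/2 * x))))
      (2 ^ n / (2 * Gamma \<alpha>) * (Gamma \<beta> /\<^sub>R \<bar>1/2\<bar>))"
    by (intro has_bochner_integral_mult_right)
  also have "(\<lambda>x. 2 ^ n / (2 * Gamma \<alpha>) *
      (indicator {0..} (0 + 1/2 * x) * ((0 + 1/2 * x) powr (\<beta> - 1) / exp (0 + 1/2 * x)))) =
      (\<lambda>x. x ^ n * chi_squared_density l x)"
  proof
    fix x :: real
    show "2 ^ n / (2 * Gamma \<alpha>) *
      (indicator {0..} (0 + 1/2 * x) * ((0 + 1/2 * x) powr (\<beta> - 1) / exp (0 + 1/2 * x))) =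
      x ^ n * chi_squared_density l x"
    proof (cases "x > 0")
      case True
      have "(1/2 * x) powr (\<beta> - 1) = x powr (\<alpha> - 1) * x ^ n * (2 / (2 powr \<alpha> * 2 ^ n))"
        using True by (simp add: \<beta>_def powr_divide powr_diff powr_add powr_realpow)
      then show ?thesis using True G
        by (simp add: chi_squared_density_def \<alpha>_def[symmetric] exp_minus field_simps)
    qed (auto simp: chi_squared_density_def indicator_def)
  qed
  also have "2 ^ n / (2 * Gamma \<alpha>) * (Gamma \<beta> /\<^sub>R \<bar>1/2\<bar>) = 2 ^ n * pochhammer \<alpha> n"
  proof -
    have "\<alpha> \<notin> \<int>\<^sub>\<le>\<^sub>0" using pos by (auto elim!: nonpos_Ints_cases)
    then show ?thesis using G by (simp add: pochhammer_Gamma \<beta>_def field_simps)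
  qed
  finally show ?thesis by (simp add: \<alpha>_def)
qed

text \<open>Integrating the exponential series term by term turns the moments into a binomial series
  in \<open>2 * \<tau>\<close>. The series of absolute values is the same binomial series at
  \<open>- cmod \<tau>\<close>, so \<open>2 * cmod \<tau> < 1\<close> justifies the
  interchange.\<close>

lemma chi_squared_laplace:
  fixes \<tau> :: complex
  assumes l: "l \<ge> 1" and \<tau>: "2 * cmod \<tau> < 1"
  shows "(\<integral>x. exp (- \<tau> * of_real x) * of_real (chi_squared_density l x) \<partial>lborel) = (1 + 2 * \<tau>) powr (- (of_nat l / 2))"
proof -
  define \<alpha> where "\<alpha> = real l / 2"
  define F where "F = (\<lambda>n x. (- \<tau>) ^ n / fact n * complex_of_real (x ^ n * chi_squared_density l x))"
  have mom: "integrable lborel (\<lambda>x. x ^ n * chi_squared_density l x)"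
    "(\<integral>x. x ^ n * chi_squared_density l x \<partial>lborel) = 2 ^ n * pochhammer \<alpha> n" for n
    using chi_squared_moment[OF l, of n] by (auto simp: has_bochner_integral_iff \<alpha>_def)
  have norm_F: "cmod (F n x) = cmod \<tau> ^ n / fact n * (x ^ n * chi_squared_density l x)" for n x
  proof (cases "x > 0")
    case True
    then show ?thesis using chi_squared_density_nonneg[of l x]
      by (simp add: F_def norm_mult norm_divide norm_power)
  qed (simp add: F_def chi_squared_density_def)
  have poch: "complex_of_real (pochhammer \<alpha> n) = pochhammer (of_nat l / 2) n" for n
    by (subst pochhammer_of_real[symmetric]) (simp add: \<alpha>_def)
  have binom: "(- (of_nat l / 2) gchoose n) * (2 * u) ^ n = (- u) ^ n / fact n * of_real (2 ^ n * pochhammer \<alpha> n)"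
    for u :: complex and n
    by (simp add: gbinomial_pochhammer power_mult_distrib poch power_minus[of u])
  have "(\<lambda>n. integral\<^sup>L lborel (F n)) sums (\<integral>x. (\<Sum>n. F n x) \<partial>lborel)"
  proof (rule sums_integral)
    show "integrable lborel (F n)" for n
      unfolding F_def using mom(1)[of n] by (intro integrable_mult_right integrable_of_real)
    have "summable (\<lambda>n. cmod (F n x))" for x
      unfolding norm_F using summable_mult2[OF summable_exp[of "cmod \<tau> * x"], of "chi_squared_density l x"]
      by (simp add: power_mult_distrib divide_inverse mult_ac)
    then show "AE x in lborel. summable (\<lambda>n. norm (F n x))" by simp
    have "(\<lambda>n. (- (of_nat l / 2) gchoose n) * (2 * - complex_of_real (cmod \<tau>)) ^ n) sums
             (1 + 2 * - complex_of_real (cmod \<tau>)) powr (- (of_nat l / 2))"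
      using \<tau> by (intro gen_binomial_complex) (simp add: norm_mult)
    then have "summable (\<lambda>n. complex_of_real (cmod \<tau> ^ n / fact n * (2 ^ n * pochhammer \<alpha> n)))"
      unfolding binom by (auto simp: sums_iff)
    then have "summable (\<lambda>n. cmod \<tau> ^ n / fact n * (2 ^ n * pochhammer \<alpha> n))"
      by (simp only: summable_of_real_iff)
    moreover have "(\<integral>x. norm (F n x) \<partial>lborel) = cmod \<tau> ^ n / fact n * (2 ^ n * pochhammer \<alpha> n)" for n
      unfolding norm_F using mom[of n] by simp
    ultimately show "summable (\<lambda>n. \<integral>x. norm (F n x) \<partial>lborel)" by simp
  qed
  moreover have "integral\<^sup>L lborel (F n) = (- (of_nat l / 2) gchoose n) * (2 * \<tau>) ^ n" for n
    unfolding F_def binom by (simp only: integral_mult_right_zero integral_complex_of_real mom(2))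
  moreover have "(\<Sum>n. F n x) = exp (- \<tau> * of_real x) * of_real (chi_squared_density l x)" for x
  proof -
    have "(\<lambda>n. (- \<tau> * of_real x) ^ n /\<^sub>R fact n * of_real (chi_squared_density l x)) sums
            (exp (- \<tau> * of_real x) * of_real (chi_squared_density l x))"
      by (intro sums_mult2 exp_converges)
    also have "(\<lambda>n. (- \<tau> * of_real x) ^ n /\<^sub>R fact n * of_real (chi_squared_density l x)) = (\<lambda>n. F n x)"
    proof
      fix n
      show "(- \<tau> * of_real x) ^ n /\<^sub>R fact n * of_real (chi_squared_density l x) = F n x"
        unfolding F_def power_mult_distrib by (simp add: scaleR_conv_of_real field_simps)
    qed
    finally show ?thesis by (simp add: sums_iff)
  qed
  ultimately have "(\<lambda>n. (- (of_nat l / 2) gchoose n) * (2 * \<tau>) ^ n) sums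
      (\<integral>x. exp (- \<tau> * of_real x) * of_real (chi_squared_density l x) \<partial>lborel)" by simp
  moreover have "(\<lambda>n. (- (of_nat l / 2) gchoose n) * (2 * \<tau>) ^ n) sums (1 + 2 * \<tau>) powr (- (of_nat l / 2))"
    using \<tau> by (intro gen_binomial_complex) (simp add: norm_mult)
  ultimately show ?thesis by (rule sums_unique2)
qed

section \<open>Reduction to a polynomial with coefficients -1, 0 and 1\<close>

definition index_diff :: "nat set \<Rightarrow> nat set \<Rightarrow> nat \<Rightarrow> complex" where
  "index_diff S T j = of_bool (j \<in> S) - of_bool (j \<in> T)"

lemma unit_coeffs_index_diff:
  assumes "S \<subseteq> {..N}" "T \<subseteq> {..N}" "S \<noteq> T"
  shows "unit_coeffs (index_diff S T) N"
proof
  show "cmod (index_diff S T j) = 1" if "index_diff S T j \<noteq> 0" for j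
    using that by (auto simp: index_diff_def of_bool_def split: if_splits)
  show "\<exists>j\<le>N. index_diff S T j \<noteq> 0"
    using assms by (fastforce simp: index_diff_def)
qed

lemma sum_index_diff:
  assumes "S \<subseteq> {..N}" "T \<subseteq> {..N}"
  shows "(\<Sum>j\<le>N. index_diff S T j * w ^ j) = (\<Sum>j\<in>S. w ^ j) - (\<Sum>j\<in>T. w ^ j)"
proof -
  have "(\<Sum>j\<le>N. of_bool (j \<in> U) * w ^ j) = (\<Sum>j\<in>U. w ^ j)" if "U \<subseteq> {..N}" for U
    using that by (intro sum.mono_neutral_cong_right) auto
  then show ?thesis using assms by (simp add: index_diff_def left_diff_distrib sum_subtractf)
qed

text \<open>Injectivity turns the sums over \<open>i\<close> into sums over the two parameter sets,
  and common parameters cancel. The factor \<open>\<kappa>\<close>, shared by all components, leaves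
  room for the decay and phase of the Gaussian transform.\<close>

lemma index_diff_le_tv_dist:
  fixes h :: "'a \<Rightarrow> complex" and l l' :: "nat \<Rightarrow> nat" and f f' :: "nat \<Rightarrow> 'a \<Rightarrow> real"
  assumes k: "k \<ge> 1" and h: "h \<in> borel_measurable B" "\<And>x. cmod (h x) \<le> 1"
    and f: "\<And>i. i \<in> {1..k} \<Longrightarrow> integrable B (f i)" "\<And>i. i \<in> {1..k} \<Longrightarrow> integrable B (f' i)"
    and hf: "\<And>i. i \<in> {1..k} \<Longrightarrow> (\<integral>x. h x * of_real (f i x) \<partial>B) = \<kappa> * w ^ l i"
      "\<And>i. i \<in> {1..k} \<Longrightarrow> (\<integral>x. h x * of_real (f' i x) \<partial>B) = \<kappa> * w ^ l' i"
    and l: "inj_on l {1..k}" "inj_on l' {1..k}" "l ` {1..k} \<subseteq> {..N}" "l' ` {1..k} \<subseteq> {..N}"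
  shows "cmod \<kappa> * cmod (\<Sum>j\<le>N. index_diff (l' ` {1..k}) (l ` {1..k}) j * w ^ j)
           \<le> 2 * real k * tv_dist B (mixture k f') (mixture k f)"
proof -
  have "(\<Sum>i=1..k. \<integral>x. h x * of_real (f' i x) \<partial>B) - (\<Sum>i=1..k. \<integral>x. h x * of_real (f i x) \<partial>B)
      = \<kappa> * ((\<Sum>i=1..k. w ^ l' i) - (\<Sum>i=1..k. w ^ l i))"
    using hf by (simp add: sum_distrib_left right_diff_distrib)
  also have "(\<Sum>i=1..k. w ^ l' i) - (\<Sum>i=1..k. w ^ l i) =
      (\<Sum>j\<le>N. index_diff (l' ` {1..k}) (l ` {1..k}) j * w ^ j)"
    using l by (simp add: sum_index_diff sum.reindex)
  finally show ?thesis
    using tv_dist_mixture_ge[of h B k f' f] h k f by (simp add: norm_mult)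
qed

section \<open>Admissibility of the test functions on a narrow chord\<close>

lemma narrow_chord_geometry:
  fixes w :: complex and s :: real
  assumes s: "0 < s" "s \<le> 1/5" and w: "Re w = 1 - 2 * s\<^sup>2" "\<bar>Im w\<bar> \<le> s"
  obtains x y where "w = Complex x y" "x = 1 - 2 * s\<^sup>2" "x \<ge> 23/25" "y\<^sup>2 \<le> s\<^sup>2" "s\<^sup>2 \<le> 1/25"
proof
  show "w = Complex (Re w) (Im w)" by simp
  show "Re w = 1 - 2 * s\<^sup>2" by fact
  show s2: "s\<^sup>2 \<le> 1/25" using power_mono[OF s(2), of 2] s by (simp add: power_divide)
  then show "Re w \<ge> 23/25" using w by simp
  show "(Im w)\<^sup>2 \<le> s\<^sup>2" using w(2) s abs_le_square_iff[of "Im w" s] by simp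
qed

text \<open>The number \<open>z = 1 + Ln w\<close> solves \<open>exp (z - 1) = w\<close>, as the
  Poisson generating function requires. With \<open>Ln w = - a + i b\<close> the bound
  \<open>(1 - a)\<^sup>2 + b\<^sup>2 \<le> 1\<close> follows from \<open>a\<^sup>2 \<le> a\<close>
  and \<open>b\<^sup>2 \<le> a\<close>; both \<open>a\<close> and \<open>b\<^sup>2\<close> are
  compared with \<open>7/5 * s\<^sup>2\<close>.\<close>

lemma norm_one_plus_Ln_le:
  fixes w :: complex and s :: real
  assumes s: "0 < s" "s \<le> 1/5" and w: "Re w = 1 - 2 * s\<^sup>2" "\<bar>Im w\<bar> \<le> s"
  shows "w \<noteq> 0" "cmod (1 + Ln w) \<le> 1"
proof -
  obtain x y where xy: "w = Complex x y" "x = 1 - 2 * s\<^sup>2" "x \<ge> 23/25" "y\<^sup>2 \<le> s\<^sup>2" "s\<^sup>2 \<le> 1/25"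
    using narrow_chord_geometry[OF assms] .
  show w0: "w \<noteq> 0" using xy by (auto simp: complex_eq_iff)
  define a where "a = - ln (cmod w)"
  have wx: "cmod w \<ge> x" using abs_Re_le_cmod[of w] xy by simp
  have w_pos: "cmod w > 0" using w0 by simp
  have "ln ((cmod w)\<^sup>2) \<le> (cmod w)\<^sup>2 - 1" using w_pos by (intro ln_le_minus_one) auto
  moreover have "ln ((cmod w)\<^sup>2) = - 2 * a" using w_pos by (simp add: a_def ln_realpow)
  moreover have "(cmod w)\<^sup>2 = x\<^sup>2 + y\<^sup>2" by (simp add: xy(1) cmod_power2)
  ultimately have "2 * a \<ge> 1 - x\<^sup>2 - y\<^sup>2" by simp
  moreover have "x\<^sup>2 = 1 - 4 * s\<^sup>2 + 4 * (s\<^sup>2)\<^sup>2" unfolding xy(2) by (simp add: power2_eq_square algebra_simps)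
  moreover have "(s\<^sup>2)\<^sup>2 \<le> s\<^sup>2 / 25"
    using mult_left_mono[OF xy(5), of "s\<^sup>2"] by (simp add: power2_eq_square[of "s\<^sup>2"])
  ultimately have "2 * a \<ge> 4 * s\<^sup>2 - 4 * (s\<^sup>2 / 25) - s\<^sup>2" using xy(4) by argo
  then have a_ge: "a \<ge> 7/5 * s\<^sup>2" using zero_le_power2[of s] by argo
  have "1 - 1 / cmod w \<le> ln (cmod w)" 
    using ln_le_minus_one[of "1 / cmod w"] w_pos by (simp add: ln_div)
  moreover have "1 / cmod w \<le> 1 / x" using wx xy(3) w_pos by (intro divide_left_mono) auto
  moreover have "1 / x \<le> 2" using xy(3) by (simp add: field_simps)
  ultimately have a_le: "a \<le> 1" by (simp add: a_def)
  have Re_Ln: "Re (Ln w) = - a" using w0 by (simp add: a_def)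
  have "Im (Ln w) = arctan (y / x)"
    using w0 xy Im_Ln_eq[of w] by simp
  then have "\<bar>Im (Ln w)\<bar> \<le> \<bar>y / x\<bar>" using abs_arctan_le[of "y / x"] by simp
  then have "(Im (Ln w))\<^sup>2 \<le> (y / x)\<^sup>2" by (simp only: abs_le_square_iff)
  also have "(y / x)\<^sup>2 \<le> 7/5 * s\<^sup>2"
  proof -
    have "(23/25)\<^sup>2 \<le> x\<^sup>2" using xy(3) by (intro power_mono) auto
    then have "7/5 * x\<^sup>2 \<ge> 1" by (simp add: power2_eq_square)
    then have "7/5 * x\<^sup>2 * s\<^sup>2 \<ge> 1 * s\<^sup>2" by (intro mult_right_mono) auto
    then have "y\<^sup>2 \<le> 7/5 * s\<^sup>2 * x\<^sup>2" using xy(4) by (simp add: mult_ac)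
    then show ?thesis using xy(3) by (simp add: power_divide pos_divide_le_eq)
  qed
  finally have Im_Ln: "(Im (Ln w))\<^sup>2 \<le> a" using a_ge by linarith
  have "a \<ge> 0" using order_trans[OF _ a_ge, of 0] by simp
  then have "a * a \<le> a * 1" using a_le by (intro mult_left_mono) auto
  then have "(1 - a)\<^sup>2 + (Im (Ln w))\<^sup>2 \<le> 1" using Im_Ln by (simp add: power2_eq_square algebra_simps)
  then have "(cmod (1 + Ln w))\<^sup>2 \<le> 1\<^sup>2" by (simp add: cmod_power2 Re_Ln)
  then show "cmod (1 + Ln w) \<le> 1" by (rule power2_le_imp_le) simp
qed

text \<open>With \<open>2 * \<tau> = 1 / w\<^sup>2 - 1\<close> this makes the Laplace kernel bounded
  on the positive axis and its series convergent. To first order in \<open>q = s\<^sup>2\<close>,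
  the bound on the real part compares \<open>1 - 6 * q\<close> with \<open>1 - 5 * q\<close>; the
  depth \<open>2 * s\<^sup>2\<close> of the chord provides this slack.\<close>

lemma inverse_square_chord:
  fixes w :: complex and s :: real
  assumes s: "0 < s" "s \<le> 1/5" and w: "Re w = 1 - 2 * s\<^sup>2" "\<bar>Im w\<bar> \<le> s"
  shows "Re w > 0" "Re (1 / w\<^sup>2) \<ge> 1" "cmod (1 / w\<^sup>2 - 1) < 1"
proof -
  obtain x y where xy: "w = Complex x y" "x = 1 - 2 * s\<^sup>2" "x \<ge> 23/25" "y\<^sup>2 \<le> s\<^sup>2" "s\<^sup>2 \<le> 1/25"
    using narrow_chord_geometry[OF assms] .
  show "Re w > 0" using xy by simp
  have w2: "(cmod w)\<^sup>2 = x\<^sup>2 + y\<^sup>2" by (simp add: xy(1) cmod_power2)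
  have pos: "x\<^sup>2 + y\<^sup>2 > 0" using xy(3) by (simp add: add_pos_nonneg)
  have "Re (1 / w\<^sup>2) = (x\<^sup>2 - y\<^sup>2) / (x\<^sup>2 + y\<^sup>2)\<^sup>2"
  proof -
    have "Re (1 / w\<^sup>2) = Re (w\<^sup>2) / (cmod (w\<^sup>2))\<^sup>2" by (simp add: Re_divide cmod_power2)
    also have "cmod (w\<^sup>2) = x\<^sup>2 + y\<^sup>2" by (simp add: norm_power w2)
    also have "Re (w\<^sup>2) = x\<^sup>2 - y\<^sup>2" by (simp add: xy(1) power2_eq_square)
    finally show ?thesis .
  qed
  moreover have "(x\<^sup>2 + y\<^sup>2)\<^sup>2 \<le> x\<^sup>2 - y\<^sup>2"
  proof -
    define q where "q = s\<^sup>2"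
    have q: "0 \<le> q" "q \<le> 1/25" using xy by (auto simp: q_def)
    have x2: "x\<^sup>2 = 1 - 4 * q + 4 * q\<^sup>2" unfolding xy(2) q_def by (simp add: power2_eq_square algebra_simps)
    have "0 \<le> x\<^sup>2 + y\<^sup>2" "x\<^sup>2 + y\<^sup>2 \<le> 1 - 3 * q + 4 * q\<^sup>2"
      using xy(4) unfolding x2 q_def[symmetric] using pos unfolding x2 by auto
    moreover have "4 * q\<^sup>2 \<le> 4/25 * q" using mult_left_mono[OF q(2,1)] by (simp add: power2_eq_square)
    ultimately have "(x\<^sup>2 + y\<^sup>2)\<^sup>2 \<le> (1 - 71/25 * q)\<^sup>2" by (intro power_mono) auto
    also have "\<dots> = 1 - 142/25 * q + 5041/625 * q\<^sup>2" by (simp add: power2_eq_square algebra_simps)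
    also have "\<dots> \<le> 1 - 5 * q + 4 * q\<^sup>2"
      using mult_left_mono[OF q(2,1)] q by (simp add: power2_eq_square)
    also have "\<dots> \<le> x\<^sup>2 - y\<^sup>2" using xy(4) x2 by (simp add: q_def)
    finally show ?thesis .
  qed
  ultimately show "Re (1 / w\<^sup>2) \<ge> 1" using zero_less_power[OF pos, of 2] by (simp add: pos_le_divide_eq)
  \<comment> \<open>The value 7/25 is \<open>2 * s\<^sup>2 + s\<close> at the extreme
    \<open>s = 1/5\<close>.\<close>
  have "cmod (1 - w) \<le> 7/25"
    using cmod_le[of "1 - w"] s xy(2,5) w by (simp add: xy(1))
  moreover have "cmod (1 + w) \<le> 2 + cmod (1 - w)"
    using norm_triangle_ineq4[of 2 "1 - w"] by simp
  ultimately have "cmod (1 - w) * cmod (1 + w) \<le> 7/25 * (57/25)"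
    by (intro mult_mono) auto
  moreover have "(23/25)\<^sup>2 \<le> x\<^sup>2" using xy(3) by (intro power_mono) auto
  then have "(23/25)\<^sup>2 \<le> (cmod w)\<^sup>2" unfolding w2 using zero_le_power2[of y] by linarith
  ultimately have "cmod (1 - w) * cmod (1 + w) < (cmod w)\<^sup>2" by (simp add: power2_eq_square)
  moreover have "cmod (1 - w\<^sup>2) = cmod (1 - w) * cmod (1 + w)"
    by (simp add: norm_mult[symmetric] power2_eq_square algebra_simps)
  moreover have "w \<noteq> 0" using xy by (auto simp: complex_eq_iff)
  then have "1 / w\<^sup>2 - 1 = (1 - w\<^sup>2) / w\<^sup>2" by (simp add: diff_divide_distrib)
  ultimately show "cmod (1 / w\<^sup>2 - 1) < 1"
    using \<open>w \<noteq> 0\<close> by (simp add: norm_divide norm_power)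
qed

text \<open>A positive real part keeps \<open>- 2 * Ln w\<close> inside the principal strip, so the
  principal power needs no branch correction.\<close>

lemma inverse_square_powr:
  assumes "Re w > 0"
  shows "(1 / w\<^sup>2) powr (- (of_nat l / 2)) = w ^ l"
proof -
  have w0: "w \<noteq> 0" using assms by auto
  have "\<bar>Im (Ln w)\<bar> < pi / 2" using assms by (rule Re_Ln_pos_lt_imp)
  then have "Ln (exp (- 2 * Ln w)) = - 2 * Ln w" by (intro Ln_exp) auto
  moreover have "exp (- 2 * Ln w) = 1 / w\<^sup>2"
    using w0 by (simp add: exp_minus exp_double divide_inverse)
  ultimately have "(1 / w\<^sup>2) powr (- (of_nat l / 2)) = exp (of_nat l * Ln w)"
    using w0 by (simp add: powr_def)
  also have "\<dots> = w ^ l" using w0 by (simp add: exp_of_nat_mult)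
  finally show ?thesis .
qed

section \<open>Bounds for Poisson, chi-squared and negative binomial mixtures\<close>

context
  fixes k N :: nat and l l' :: "nat \<Rightarrow> nat"
  assumes k: "k \<ge> 1" and N: "N \<ge> 1"
    and l: "l ` {1..k} \<subseteq> {..N}" "l' ` {1..k} \<subseteq> {..N}"
    and inj: "inj_on l {1..k}" "inj_on l' {1..k}"
    and diff: "l ` {1..k} \<noteq> l' ` {1..k}"
begin

interpretation unit_coeffs "index_diff (l' ` {1..k}) (l ` {1..k})" N
  using l diff by (intro unit_coeffs_index_diff) auto

lemma poisson_mixture_bound:
  "2 * real k * tv_dist (count_space UNIV) (mixture k (\<lambda>i. pmf (Poi (real (l' i)))))
     (mixture k (\<lambda>i. pmf (Poi (real (l i))))) \<ge> exp (- 201 * root 3 (real N))"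
proof (rule narrow_chord_lower_bound[OF N])
  fix w :: complex and s :: real
  assume s: "0 < s" "s \<le> 1/5" and w: "Re w = 1 - 2 * s\<^sup>2" "\<bar>Im w\<bar> \<le> s"
  note z = norm_one_plus_Ln_le[OF s w]
  have int: "(\<integral>n. (1 + Ln w) ^ n * of_real (pmf (Poi (real j)) n) \<partial>count_space UNIV) = 1 * w ^ j" for j
    using Poi_pgf[OF z(2), of j] z(1) by simp
  have "cmod 1 * cmod (\<Sum>j\<le>N. index_diff (l' ` {1..k}) (l ` {1..k}) j * w ^ j) \<le>
     2 * real k * tv_dist (count_space UNIV) (mixture k (\<lambda>i. pmf (Poi (real (l' i)))))
     (mixture k (\<lambda>i. pmf (Poi (real (l i)))))"
  proof (rule index_diff_le_tv_dist[where h = "\<lambda>n. (1 + Ln w) ^ n", OF k _ _ _ _ int int inj l])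
    show "cmod ((1 + Ln w) ^ n) \<le> 1" for n using z(2) by (simp add: norm_power power_le_one)
  qed (auto intro: integrable_pmf_count_space)
  then show "cmod (\<Sum>j\<le>N. index_diff (l' ` {1..k}) (l ` {1..k}) j * w ^ j) \<le>
     2 * real k * tv_dist (count_space UNIV) (mixture k (\<lambda>i. pmf (Poi (real (l' i)))))
     (mixture k (\<lambda>i. pmf (Poi (real (l i)))))" by simp
qed

lemma chi_squared_mixture_bound:
  assumes pos: "\<And>i. i \<in> {1..k} \<Longrightarrow> l i \<ge> 1" "\<And>i. i \<in> {1..k} \<Longrightarrow> l' i \<ge> 1"
  shows "2 * real k * tv_dist lborel (mixture k (\<lambda>i. chi_squared_density (l' i)))
     (mixture k (\<lambda>i. chi_squared_density (l i))) \<ge> exp (- 201 * root 3 (real N))"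
proof (rule narrow_chord_lower_bound[OF N])
  fix w :: complex and s :: real
  assume s: "0 < s" "s \<le> 1/5" and w: "Re w = 1 - 2 * s\<^sup>2" "\<bar>Im w\<bar> \<le> s"
  \<comment> \<open>Chosen so that the Laplace transform
    \<open>(1 + 2 * \<tau>) powr (- (l / 2))\<close> becomes \<open>w ^ l\<close>.\<close>
  define \<tau> where "\<tau> = (1 / w\<^sup>2 - 1) / 2"
  note chord = inverse_square_chord[OF s w]
  have "w \<noteq> 0" using chord(1) by auto
  then have \<tau>: "1 + 2 * \<tau> = 1 / w\<^sup>2" "Re \<tau> \<ge> 0" "2 * cmod \<tau> < 1"
    using chord(2,3) by (simp add: \<tau>_def field_simps) (use chord(2,3) in \<open>simp_all add: \<tau>_def norm_divide\<close>)
  \<comment> \<open>Cut off at \<open>0\<close>, since the exponential is unbounded on the negative axis.\<close>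
  define h where "h = (\<lambda>x::real. indicator {0<..} x *\<^sub>R exp (- \<tau> * of_real x))"
  have int: "(\<integral>x. h x * of_real (chi_squared_density j x) \<partial>lborel) = 1 * w ^ j" if "j \<ge> 1" for j
  proof -
    have "(\<integral>x. h x * of_real (chi_squared_density j x) \<partial>lborel) =
          (\<integral>x. exp (- \<tau> * of_real x) * of_real (chi_squared_density j x) \<partial>lborel)"
      by (intro Bochner_Integration.integral_cong) (auto simp: h_def chi_squared_density_def)
    also have "\<dots> = 1 * w ^ j"
      using chi_squared_laplace[OF that \<tau>(3)] inverse_square_powr[OF chord(1)] by (simp add: \<tau>(1))
    finally show ?thesis .
  qed
  have "cmod 1 * cmod (\<Sum>j\<le>N. index_diff (l' ` {1..k}) (l ` {1..k}) j * w ^ j) \<le>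
     2 * real k * tv_dist lborel (mixture k (\<lambda>i. chi_squared_density (l' i)))
     (mixture k (\<lambda>i. chi_squared_density (l i)))"
  proof (rule index_diff_le_tv_dist[where h = h, OF k _ _ _ _ int int inj l])
    show "h \<in> borel_measurable lborel" unfolding h_def by measurable
    show "cmod (h x) \<le> 1" for x using \<tau>(2) by (auto simp: h_def indicator_def)
    show "integrable lborel (chi_squared_density (l i))" if "i \<in> {1..k}" for i
      using chi_squared_moment[OF pos(1)[OF that], of 0] by (simp add: has_bochner_integral_iff)
    show "integrable lborel (chi_squared_density (l' i))" if "i \<in> {1..k}" for i
      using chi_squared_moment[OF pos(2)[OF that], of 0] by (simp add: has_bochner_integral_iff)
  qed (use pos in auto)
  then show "cmod (\<Sum>j\<le>N. index_diff (l' ` {1..k}) (l ` {1..k}) j * w ^ j) \<le>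
     2 * real k * tv_dist lborel (mixture k (\<lambda>i. chi_squared_density (l' i)))
     (mixture k (\<lambda>i. chi_squared_density (l i)))" by simp
qed

lemma NB_mixture_bound:
  assumes p: "0 < p" "p < 1"
  shows "2 * real k * tv_dist (count_space UNIV) (mixture k (\<lambda>i. pmf (NB (l' i) p)))
     (mixture k (\<lambda>i. pmf (NB (l i) p))) \<ge> exp (- 1200 * root 3 (real N / p))" (is "?T \<ge> _")
proof -
  have le: "cmod (\<Sum>j\<le>N. index_diff (l' ` {1..k}) (l ` {1..k}) j * w ^ j) \<le> ?T"
    if w: "cmod (w - of_real (1 - p)) \<le> p * cmod w" for w
  proof -
    have w0: "w \<noteq> 0" using w p norm_of_real[of "1 - p", where 'a = complex] by (auto simp del: of_real_diff)
    \<comment> \<open>This inverts the Moebius map \<open>w = (1 - p) / (1 - p * z)\<close> of the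
      generating function; the disc condition on \<open>w\<close> says exactly that
      \<open>cmod z \<le> 1\<close>.\<close>
    define z where "z = (1 - of_real (1 - p) / w) / of_real p"
    have "z = (w - of_real (1 - p)) / (of_real p * w)" using w0 p by (simp add: z_def field_simps)
    then have z: "cmod z \<le> 1" using w w0 p by (simp add: norm_divide norm_mult)
    have "1 - of_real p * z = of_real (1 - p) / w" using p by (simp add: z_def)
    moreover have "complex_of_real (1 - p) \<noteq> 0" using p by (simp del: of_real_diff)
    ultimately have wz: "of_real (1 - p) / (1 - of_real p * z) = w" using w0 by simp
    have int: "(\<integral>n. z ^ n * of_real (pmf (NB j p) n) \<partial>count_space UNIV) = 1 * w ^ j" for j
      using NB_pgf[OF p z, of j] by (simp only: wz mult_1)
    have "cmod 1 * cmod (\<Sum>j\<le>N. index_diff (l' ` {1..k}) (l ` {1..k}) j * w ^ j) \<le> ?T"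
    proof (rule index_diff_le_tv_dist[where h = "\<lambda>n. z ^ n", OF k _ _ _ _ int int inj l])
      show "cmod (z ^ n) \<le> 1" for n using z by (simp add: norm_power power_le_one)
    qed (auto intro: integrable_pmf_count_space)
    then show ?thesis by simp
  qed
  show ?thesis
  proof (cases "1 \<le> real N * p\<^sup>2")
    case True
    have "exp (- 1200 * root 3 (real N / p)) \<le> exp (- 81 * root 3 (real N / p))" using p by simp
    then show ?thesis using disc_lower_bound_large[OF p True le] by linarith
  next
    case False
    then show ?thesis using disc_lower_bound_small[OF N p _ le] by simp
  qed
qed

end

section \<open>Bound for Gaussian mixtures\<close>

lemma sin_ge_half:
  fixes x :: real
  assumes "0 \<le> x" "x \<le> 1"
  shows "sin x \<ge> x / 2"
proof -
  have sum_eq: "(\<Sum>m<2. sin_coeff m * x ^ m) = x"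
    by (simp add: lessThan_nat_numeral sin_coeff_def)
  have "\<bar>sin x - x\<bar> \<le> inverse (fact 2) * \<bar>x\<bar>\<^sup>2"
    using Maclaurin_sin_bound[of x 2] unfolding sum_eq .
  also have "\<dots> = x * x / 2" by (simp add: power2_eq_square)
  also have "\<dots> \<le> x * 1 / 2" using assms by (intro divide_right_mono mult_left_mono) auto
  finally show ?thesis by linarith
qed

text \<open>At frequency \<open>\<theta> / \<epsilon>\<close> the grid points become powers of
  \<open>cis \<theta>\<close>, up to a common factor. The arc bound is then weighed against the
  decay of the Gaussian transform; the additive constant in the exponent covers small
  \<open>\<sigma> / \<epsilon>\<close>.\<close>

lemma gaussian_mixture_bound:
  fixes \<sigma> \<epsilon> u :: real and \<mu> \<mu>' :: "nat \<Rightarrow> real" and k :: nat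
  defines "u \<equiv> (\<sigma> / \<epsilon>) powr (2/3)"
  assumes k: "k \<ge> 1" and pos: "\<sigma> > 0" "\<epsilon> > 0"
    and grid: "\<forall>i\<in>{1..k}. \<exists>z::int. \<mu> i = \<epsilon> * of_int z" "\<forall>i\<in>{1..k}. \<exists>z::int. \<mu>' i = \<epsilon> * of_int z"
    and inj: "inj_on \<mu> {1..k}" "inj_on \<mu>' {1..k}" and diff: "\<mu> ` {1..k} \<noteq> \<mu>' ` {1..k}"
  shows "2 * real k * tv_dist lborel (mixture k (\<lambda>i. normal_density (\<mu>' i) \<sigma>))
           (mixture k (\<lambda>i. normal_density (\<mu> i) \<sigma>)) \<ge> exp (- 81 * (1 + u))" (is "?T \<ge> _")
proof -
  obtain z z' :: "nat \<Rightarrow> int" where z: "\<And>i. i \<in> {1..k} \<Longrightarrow> \<mu> i = \<epsilon> * of_int (z i)"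
      "\<And>i. i \<in> {1..k} \<Longrightarrow> \<mu>' i = \<epsilon> * of_int (z' i)"
    using grid by metis
  define Z where "Z = z ` {1..k} \<union> z' ` {1..k}"
  have Z: "finite Z" by (simp add: Z_def)
  \<comment> \<open>Subtracting the smallest integer makes all exponents natural numbers. The shift
    returns only as a phase of modulus 1 in \<open>\<kappa>\<close>.\<close>
  define z0 where "z0 = Min Z"
  define l l' where "l = (\<lambda>i. nat (z i - z0))" and "l' = (\<lambda>i. nat (z' i - z0))"
  have zl: "z i = z0 + int (l i)" "z' i = z0 + int (l' i)" if "i \<in> {1..k}" for i
    using that Min_le[OF Z] by (auto simp: l_def l'_def z0_def Z_def)
  define emb where "emb = (\<lambda>n::nat. \<epsilon> * of_int (z0 + int n))"
  have emb: "\<mu> i = emb (l i)" "\<mu>' i = emb (l' i)" if "i \<in> {1..k}" for i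
    using that z zl by (auto simp: emb_def)
  define N where "N = Max (l ` {1..k} \<union> l' ` {1..k})"
  have lN: "l ` {1..k} \<subseteq> {..N}" "l' ` {1..k} \<subseteq> {..N}"
    by (auto simp: N_def intro!: Max_ge)
  have inj_l: "inj_on l {1..k}"
  proof (rule inj_onI)
    fix i j assume "i \<in> {1..k}" "j \<in> {1..k}" "l i = l j"
    then show "i = j" using inj_onD[OF inj(1), of i j] emb(1)[of i] emb(1)[of j] by simp
  qed
  have inj_l': "inj_on l' {1..k}"
  proof (rule inj_onI)
    fix i j assume "i \<in> {1..k}" "j \<in> {1..k}" "l' i = l' j"
    then show "i = j" using inj_onD[OF inj(2), of i j] emb(2)[of i] emb(2)[of j] by simp
  qed
  have "\<mu> ` {1..k} = emb ` l ` {1..k}" "\<mu>' ` {1..k} = emb ` l' ` {1..k}"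
    unfolding image_image by (intro image_cong refl emb, assumption)+
  then have "l ` {1..k} \<noteq> l' ` {1..k}" using diff by metis
  then interpret unit_coeffs "index_diff (l' ` {1..k}) (l ` {1..k})" N
    using lN by (intro unit_coeffs_index_diff) auto
  define y where "y = \<sigma> / \<epsilon>"
  have y: "y > 0" using pos by (simp add: y_def)
  have u0: "u > 0" using pos by (simp add: u_def)
  have "u powr real 3 = y powr real 2" by (simp add: u_def y_def powr_powr)
  then have u: "u > 0" "u ^ 3 = y\<^sup>2"
    using u0 y unfolding powr_realpow[OF u0] powr_realpow[OF y] by auto
  \<comment> \<open>Balances the decay exponent
    \<open>(y * \<delta>)\<^sup>2 / 2 \<le> u / 2\<close> against the cost
    \<open>40 / sin \<delta> \<le> 80 * (1 + u)\<close>. Taking \<open>1 + u\<close> in place of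
    \<open>u\<close> keeps \<open>\<delta> \<le> 1\<close> for small \<open>u\<close> as
    well.\<close>
  define \<delta> where "\<delta> = 1 / (1 + u)"
  have \<delta>: "0 < \<delta>" "\<delta> \<le> 1" using u by (auto simp: \<delta>_def)
  have y\<delta>: "(y * \<delta>)\<^sup>2 \<le> u"
  proof -
    have "u ^ 3 \<le> u * (1 + u)\<^sup>2" using u(1) by (simp add: power2_eq_square power3_eq_cube algebra_simps)
    then show ?thesis using u by (simp add: \<delta>_def power_divide power_mult_distrib pos_divide_le_eq)
  qed
  have "?T * exp (u / 2) \<ge> exp (- 40 / sin \<delta>)"
  proof (rule arc_lower_bound[OF \<delta>])
    fix \<theta> :: real assume \<theta>: "\<bar>\<theta>\<bar> \<le> \<delta>"
    define t where "t = \<theta> / \<epsilon>"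
    define \<kappa> where "\<kappa> = of_real (exp (- (\<sigma> * t)\<^sup>2 / 2)) * cis (\<theta> * of_int z0)"
    have int: "(\<integral>x. cis (t * x) * of_real (normal_density (emb n) \<sigma> x) \<partial>lborel) = \<kappa> * cis \<theta> ^ n" for n
    proof -
      have "t * emb n = \<theta> * of_int z0 + real n * \<theta>" using pos by (simp add: t_def emb_def algebra_simps)
      then have "cis (t * emb n) = cis (\<theta> * of_int z0) * cis \<theta> ^ n"
        by (simp only: Complex.DeMoivre cis_mult)
      then show ?thesis
        unfolding normal_density_fourier[OF pos(1)] by (simp add: \<kappa>_def mult.assoc)
    qed
    have "cmod \<kappa> * cmod (\<Sum>j\<le>N. index_diff (l' ` {1..k}) (l ` {1..k}) j * cis \<theta> ^ j) \<le> ?T"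
    proof (rule index_diff_le_tv_dist[where h = "\<lambda>x. cis (t * x)", OF k _ _ _ _ _ _ inj_l inj_l' lN])
      show "(\<lambda>x. cis (t * x)) \<in> borel_measurable lborel"
        unfolding cis_conv_exp by measurable
    qed (use pos emb int in auto)
    moreover have "exp (- u / 2) \<le> cmod \<kappa>"
    proof -
      have "\<bar>\<sigma> * t\<bar> = y * \<bar>\<theta>\<bar>" using pos by (simp add: t_def y_def abs_mult)
      also have "\<dots> \<le> y * \<delta>" using \<theta> y by (intro mult_left_mono) auto
      finally have "\<bar>\<sigma> * t\<bar>\<^sup>2 \<le> (y * \<delta>)\<^sup>2" by (intro power_mono) auto
      then show ?thesis using y\<delta> by (simp add: \<kappa>_def norm_mult)
    qed
    ultimately have "exp (- u / 2) * cmod (\<Sum>j\<le>N. index_diff (l' ` {1..k}) (l ` {1..k}) j * cis \<theta> ^ j) \<le> ?T"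
      by (meson mult_right_mono norm_ge_zero order_trans)
    then show "cmod (\<Sum>j\<le>N. index_diff (l' ` {1..k}) (l ` {1..k}) j * cis \<theta> ^ j) \<le> ?T * exp (u / 2)"
      by (simp add: exp_minus field_simps)
  qed
  moreover have "exp (- 80 * (1 + u)) \<le> exp (- 40 / sin \<delta>)"
  proof -
    have "\<delta> / 2 \<le> sin \<delta>" "0 < \<delta> / 2" using sin_ge_half[of \<delta>] \<delta> by auto
    then have "40 / sin \<delta> \<le> 40 / (\<delta> / 2)" by (intro divide_left_mono) auto
    also have "\<dots> = 80 * (1 + u)" by (simp add: \<delta>_def)
    finally show ?thesis by simp
  qed
  ultimately have "exp (- 80 * (1 + u)) \<le> ?T * exp (u / 2)" by linarith
  then have "exp (- 80 * (1 + u)) * exp (- u / 2) \<le> ?T * exp (u / 2) * exp (- u / 2)"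
    by (intro mult_right_mono) auto
  then have "exp (- 80 * (1 + u) - u / 2) \<le> ?T" by (simp add: exp_add[symmetric] mult.assoc)
  moreover have "exp (- 81 * (1 + u)) \<le> exp (- 80 * (1 + u) - u / 2)" using u by simp
  ultimately show ?thesis by linarith
qed

section \<open>The common absolute constant\<close>

text \<open>The factor 2 and the additive exponent \<open>a\<close> are absorbed by the prefactor
  \<open>inverse C\<close>, the rate \<open>c\<close> by the rate \<open>C\<close>.\<close>

lemma weaken_constant:
  fixes k :: nat and c T t C :: real
  assumes k: "k \<ge> 1" and T: "2 * real k * T \<ge> exp (- a - c * t)" and t: "t \<ge> 0" and C: "C \<ge> c" "C \<ge> 2 * exp a"
  shows "T \<ge> inverse C * inverse (real k) * exp (- C * t)"
proof -
  have "inverse C * inverse (real k) * exp (- C * t) \<le> inverse (2 * exp a) * inverse (real k) * exp (- c * t)"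
    using C t k by (intro mult_mono le_imp_inverse_le) (auto intro: mult_right_mono order_less_le_trans[of 0 "2 * exp a"])
  also have "\<dots> = exp (- a - c * t) / (2 * real k)"
    by (simp add: exp_diff exp_minus field_simps)
  also have "\<dots> \<le> T" using T k by (simp add: field_simps)
  finally show ?thesis .
qed

theorem theorem7:
  shows "\<exists>C::real. C > 0 \<and> (\<forall>k::nat. k \<ge> 1 \<longrightarrow>
    (\<forall>(\<sigma>::real) (\<epsilon>::real) (\<mu>::nat \<Rightarrow> real) (\<mu>'::nat \<Rightarrow> real).
       \<sigma> > 0 \<longrightarrow> \<epsilon> > 0 \<longrightarrow>
       (\<forall>i\<in>{1..k}. \<exists>z::int. \<mu> i = \<epsilon> * of_int z) \<longrightarrow>
       (\<forall>i\<in>{1..k}. \<exists>z::int. \<mu>' i = \<epsilon> * of_int z) \<longrightarrow>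
       inj_on \<mu> {1..k} \<longrightarrow> inj_on \<mu>' {1..k} \<longrightarrow> \<mu> ` {1..k} \<noteq> \<mu>' ` {1..k} \<longrightarrow>
       tv_dist lborel (mixture k (\<lambda>i. normal_density (\<mu>' i) \<sigma>))
                      (mixture k (\<lambda>i. normal_density (\<mu> i) \<sigma>))
         \<ge> inverse C * inverse (real k) * exp (- C * (\<sigma> / \<epsilon>) powr (2 / 3))) \<and>
    (\<forall>(N::nat) (l::nat \<Rightarrow> nat) (l'::nat \<Rightarrow> nat).
       N \<ge> 1 \<longrightarrow>
       (\<forall>i\<in>{1..k}. l i \<in> {0..N}) \<longrightarrow> (\<forall>i\<in>{1..k}. l' i \<in> {0..N}) \<longrightarrow>
       inj_on l {1..k} \<longrightarrow> inj_on l' {1..k} \<longrightarrow> l ` {1..k} \<noteq> l' ` {1..k} \<longrightarrow>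
       tv_dist (count_space UNIV) (mixture k (\<lambda>i. pmf (Poi (real (l' i)))))
                                  (mixture k (\<lambda>i. pmf (Poi (real (l i)))))
         \<ge> inverse C * inverse (real k) * exp (- C * real N powr (1 / 3))) \<and>
    (\<forall>(N::nat) (l::nat \<Rightarrow> nat) (l'::nat \<Rightarrow> nat).
       N \<ge> 1 \<longrightarrow>
       (\<forall>i\<in>{1..k}. l i \<in> {1..N}) \<longrightarrow> (\<forall>i\<in>{1..k}. l' i \<in> {1..N}) \<longrightarrow>
       inj_on l {1..k} \<longrightarrow> inj_on l' {1..k} \<longrightarrow> l ` {1..k} \<noteq> l' ` {1..k} \<longrightarrow>
       tv_dist lborel (mixture k (\<lambda>i. chi_squared_density (l' i)))
                      (mixture k (\<lambda>i. chi_squared_density (l i)))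
         \<ge> inverse C * inverse (real k) * exp (- C * real N powr (1 / 3))) \<and>
    (\<forall>(N::nat) (p::real) (r::nat \<Rightarrow> nat) (r'::nat \<Rightarrow> nat).
       N \<ge> 1 \<longrightarrow> 0 < p \<longrightarrow> p < 1 \<longrightarrow>
       (\<forall>i\<in>{1..k}. r i \<in> {1..N}) \<longrightarrow> (\<forall>i\<in>{1..k}. r' i \<in> {1..N}) \<longrightarrow>
       inj_on r {1..k} \<longrightarrow> inj_on r' {1..k} \<longrightarrow> r ` {1..k} \<noteq> r' ` {1..k} \<longrightarrow>
       tv_dist (count_space UNIV) (mixture k (\<lambda>i. pmf (NB (r' i) p)))
                                  (mixture k (\<lambda>i. pmf (NB (r i) p)))
         \<ge> inverse C * inverse (real k) * exp (- C * (real N / p) powr (1 / 3))))"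
proof -
  \<comment> \<open>1200 is the largest of the rates 81, 201 and 1200; the term
    \<open>2 * exp 81\<close> pays for the additive 81 of the Gaussian exponent.\<close>
  define C :: real where "C = 1200 + 2 * exp 81"
  have C: "C > 0" "C \<ge> 81" "C \<ge> 201" "C \<ge> 1200" "C \<ge> 2 * exp 81" "C \<ge> 2 * exp 0"
    using exp_gt_zero[of "81::real"] unfolding C_def exp_zero by linarith+
  have root: "root 3 t = t powr (1/3)" if "t > 0" for t :: real
    using that by (simp add: root_powr_inverse)
  show ?thesis
  proof (rule exI[of _ C], intro conjI allI impI, goal_cases)
    case 1
    show ?case by (rule C)
  next
    case (2 k \<sigma> \<epsilon> \<mu> \<mu>')
    show ?case
      by (rule weaken_constant[where a = 81 and c = 81])
        (use 2 C gaussian_mixture_bound[of k \<sigma> \<epsilon> \<mu> \<mu>'] in \<open>simp_all add: algebra_simps\<close>)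
  next
    case (3 k N l l')
    have "l ` {1..k} \<subseteq> {..N}" "l' ` {1..k} \<subseteq> {..N}" using 3 by auto
    then show ?case
      using poisson_mixture_bound[of k N l l'] 3 C
      by (intro weaken_constant[where a = 0 and c = 201]) (simp_all add: root)
  next
    case (4 k N l l')
    have "l ` {1..k} \<subseteq> {..N}" "l' ` {1..k} \<subseteq> {..N}" using 4 by auto
    then show ?case
      using chi_squared_mixture_bound[of k N l l'] 4 C
      by (intro weaken_constant[where a = 0 and c = 201]) (simp_all add: root)
  next
    case (5 k N p r r')
    have "r ` {1..k} \<subseteq> {..N}" "r' ` {1..k} \<subseteq> {..N}" using 5 by auto
    then show ?case
      using NB_mixture_bound[of k N r r' p] 5 C
      by (intro weaken_constant[where a = 0 and c = 1200]) (simp_all add: root)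
  qed
qed

end
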